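(* Consider the system $$-\Delta u=|x|^a u^s v^\delta,\qquad -\Delta v=|x|^a u^\mu v^s,$$ with $N>2$, $a>-2$. Define a curve $\mathcal C_s$ in the plane $(\delta,\mu)$ by $$\frac{N+a}{\mu+1}+\frac{N+a}{\delta+1}=N-2+\frac{(N-2)s}{2}\min\Big(\frac1{\mu+1},\frac1{\delta+1}\Big),$$ located under the hyperbola of equation $\frac{N+a}{\delta+1}+\frac{N+a}{\mu+1}=N-2$. If $(\delta,\mu)$ is above $\mathcal C_s$, the system admits a ground state (G.S.).
   Context: Standing assumptions: $s>0$, $\delta,\mu>0$ and $D=\delta\mu-(1-s)^2>0$. "$(\delta,\mu)$ is above $\mathcal C_s$" means $$\frac{N+a}{\mu+1}+\frac{N+a}{\delta+1}<N-2+\frac{(N-2)s}{2}\min\Big(\frac1{\mu+1},\frac1{\delta+1}\Big).$$ A positive radial solution $r=|x|\mapsto(u(r),v(r))$ on $(0,R)$ is regular at $0$ if $u,v\in C^2(0,R)\cap C([0,R))$. A ground state (G.S.) is a radial solution $(u,v)$, positive on $(0,\infty)$ and regular at $0$. *)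

theory Defs
  imports "HOL-Analysis.Analysis"
begin

definition laplacian :: "('n::euclidean_space \<Rightarrow> real) \<Rightarrow> 'n \<Rightarrow> real" where
  "laplacian f x = (\<Sum>b\<in>Basis. (deriv ^^ 2) (\<lambda>t. f (x + t *\<^sub>R b)) 0)"

text \<open>Class C2 on a set, used for open sets of reals only (the derivatives are two-sided).\<close>

definition C2_on :: "real set \<Rightarrow> (real \<Rightarrow> real) \<Rightarrow> bool" where
  "C2_on S f \<longleftrightarrow>
     (\<forall>r\<in>S. f field_differentiable (at r)) \<and>
     (\<forall>r\<in>S. deriv f field_differentiable (at r)) \<and>
     continuous_on S (deriv (deriv f))"

text \<open>
  The profiles \<open>u\<close>, \<open>v\<close> are functions of \<open>r = |x|\<close>; the type argument is the ambient
  Euclidean space, on which the partial differential equations are imposed. The equations are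
  required away from the origin, where the weight \<open>|x|\<^sup>a\<close> is regular; the behaviour at
  the origin is the subject of \<open>regular_at_0\<close>. As the profiles are positive, \<open>powr\<close>
  is only applied to positive bases.
\<close>

definition positive_radial_solution ::
  "'n::euclidean_space itself \<Rightarrow> real \<Rightarrow> real \<Rightarrow> real \<Rightarrow> real \<Rightarrow> ereal \<Rightarrow>
     (real \<Rightarrow> real) \<Rightarrow> (real \<Rightarrow> real) \<Rightarrow> bool" where
  "positive_radial_solution _ a s \<delta> \<mu> R u v \<longleftrightarrow>
     C2_on (einterval 0 R) u \<and> C2_on (einterval 0 R) v \<and>
     (\<forall>r\<in>einterval 0 R. u r > 0 \<and> v r > 0) \<and>
     (\<forall>x::'n. norm x \<in> einterval 0 R \<longrightarrow>
        - laplacian (\<lambda>y::'n. u (norm y)) x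
            = norm x powr a * u (norm x) powr s * v (norm x) powr \<delta> \<and>
        - laplacian (\<lambda>y::'n. v (norm y)) x
            = norm x powr a * u (norm x) powr \<mu> * v (norm x) powr s)"

definition regular_at_0 :: "ereal \<Rightarrow> (real \<Rightarrow> real) \<Rightarrow> (real \<Rightarrow> real) \<Rightarrow> bool" where
  "regular_at_0 R u v \<longleftrightarrow>
     C2_on (einterval 0 R) u \<and> C2_on (einterval 0 R) v \<and>
     continuous_on {r. 0 \<le> r \<and> ereal r < R} u \<and>
     continuous_on {r. 0 \<le> r \<and> ereal r < R} v"

definition ground_state ::
  "'n::euclidean_space itself \<Rightarrow> real \<Rightarrow> real \<Rightarrow> real \<Rightarrow> real \<Rightarrow>
     (real \<Rightarrow> real) \<Rightarrow> (real \<Rightarrow> real) \<Rightarrow> bool" where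
  "ground_state T a s \<delta> \<mu> u v \<longleftrightarrow>
     positive_radial_solution T a s \<delta> \<mu> \<infinity> u v \<and> regular_at_0 \<infinity> u v"

text \<open>
  Curves and regions in the open first quadrant of the \<open>(\<delta>, \<mu>)\<close> plane, with \<open>N\<close> the
  space dimension. "Above" and "under" are given by strict inequalities: replacing the equality
  in the equation by \<open><\<close> gives the points above the curve, replacing it by \<open>>\<close>
  the points under it. For the hyperbola this is the geometric meaning, its left-hand side being
  decreasing in \<open>\<delta>\<close> and \<open>\<mu>\<close>.
\<close>

definition curve_C :: "real \<Rightarrow> real \<Rightarrow> real \<Rightarrow> (real \<times> real) set" where
  "curve_C N a s = {(\<delta>, \<mu>). \<delta> > 0 \<and> \<mu> > 0 \<and>
     (N + a) / (\<mu> + 1) + (N + a) / (\<delta> + 1)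
       = N - 2 + (N - 2) * s / 2 * min (1 / (\<mu> + 1)) (1 / (\<delta> + 1))}"

definition above_C :: "real \<Rightarrow> real \<Rightarrow> real \<Rightarrow> (real \<times> real) set" where
  "above_C N a s = {(\<delta>, \<mu>). \<delta> > 0 \<and> \<mu> > 0 \<and>
     (N + a) / (\<mu> + 1) + (N + a) / (\<delta> + 1)
       < N - 2 + (N - 2) * s / 2 * min (1 / (\<mu> + 1)) (1 / (\<delta> + 1))}"

definition under_hyperbola :: "real \<Rightarrow> real \<Rightarrow> (real \<times> real) set" where
  "under_hyperbola N a = {(\<delta>, \<mu>). \<delta> > 0 \<and> \<mu> > 0 \<and>
     (N + a) / (\<delta> + 1) + (N + a) / (\<mu> + 1) > N - 2}"

end

theory Submission
  imports Defs "HOL-Complex_Analysis.Great_Picard"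
begin

text \<open>
  The first claim is immediate, as the term that distinguishes the curve from the hyperbola is
  positive. For the second one the Emden change of variable \<open>x = r\<^bsup>2+a\<^esup> / (2+a)\<^sup>2\<close> removes the
  weight: with \<open>\<kappa> = (N+a)/(2+a) > 1\<close> radial solutions of the system are the solutions of

  \<open>(x\<^sup>\<kappa> u')' = - x\<^bsup>\<kappa>-1\<^esup> u\<^sup>s v\<^sup>\<delta>,   (x\<^sup>\<kappa> v')' = - x\<^bsup>\<kappa>-1\<^esup> u\<^sup>\<mu> v\<^sup>s\<close>,

  and, after division by \<open>2 + a\<close>, being above the curve reads
  \<open>\<kappa>/(\<mu>+1) + \<kappa>/(\<delta>+1) < (\<kappa>-1) (1 + (s/2) min (1/(\<mu>+1)) (1/(\<delta>+1)))\<close>.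
  Replacing negative values of \<open>u\<close> and \<open>v\<close> by \<open>0\<close> in the sources makes solutions
  nonincreasing and global; a ground state is a solution that never reaches \<open>0\<close>.

  \<^bold>\<open>Two Pohozaev obstructions.\<close> If \<open>\<kappa>/(s+1) \<le> (\<kappa>-1)/2\<close>, the equation for \<open>u\<close> alone, with \<open>v\<close> seen
  as a decreasing coefficient, is critical or supercritical, so neither component can vanish
  (\<open>no_zero_supercritical\<close>) and every regular solution is a ground state. Otherwise a component may
  vanish, but above the curve the two cannot vanish at the same point (\<open>no_simultaneous_zero\<close>). With
  the slopes \<open>X = -x u'/u\<close>, \<open>Y = -x v'/v\<close> and \<open>n = \<kappa>-1\<close>, the usual Pohozaev energy of the pair,
  to which a multiple of \<open>u v x\<^sup>n (\<phi>(X) + \<phi>(Y))\<close> with \<open>\<phi>(X) = X min(X, n)/2\<close> is added, decreases: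
  this comes down to the elementary \<open>slope_inequality\<close> and is where the term
  \<open>(s/2) min (1/(\<mu>+1)) (1/(\<delta>+1))\<close> comes from. The energy is \<open>0\<close> at the origin and would be positive at a
  common zero.

  \<^bold>\<open>Shooting.\<close> It remains to find, in the subcritical case, a solution of which no component vanishes
  before the other. Since \<open>\<delta>\<mu> \<noteq> (1-s)\<^sup>2\<close>, multiplying \<open>u\<close> and \<open>v\<close> by constants turns any positive
  coefficients of the two sources into \<open>1\<close> (\<open>weighted_pair_rescale\<close>). So one may start at
  \<open>u(0) = v(0) = 1\<close> and shoot on the coefficients \<open>1-t\<close> and \<open>t\<close> of the sources, \<open>t \<in> [0,1]\<close>. For
  \<open>t = 0\<close> one has \<open>v = 1\<close> and \<open>u\<close> solves a subcritical Lane--Emden equation, hence vanishes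
  (\<open>subcritical_zero\<close>); for \<open>t = 1\<close> the roles are exchanged. The sets of \<open>t\<close> for which \<open>u\<close>, respectively
  \<open>v\<close>, vanishes strictly first are open and disjoint, so by connectedness some \<open>t\<close> lies in neither
  (\<open>balanced_pair_exists\<close>).

  \<^bold>\<open>No uniqueness.\<close> The sources are not Lipschitz at \<open>0\<close> for small exponents. Therefore the connectedness argument
  is made for approximate solutions with a small delay, which are computed step by step and depend
  continuously on \<open>t\<close>; being in neither set is a closed condition and passes to a limit
  (\<open>approx_limit\<close>).
\<close>

section \<open>Radial means and potentials\<close>

text \<open>This is \<open>x\<^bsup>-\<kappa>\<^esup>\<close> times the integral of \<open>z\<^bsup>\<kappa>-1\<^esup> f(z)\<close> over \<open>[0, x]\<close>, that is \<open>-u'\<close> for the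
  regular solution of \<open>(x\<^sup>\<kappa> u')' = - x\<^bsup>\<kappa>-1\<^esup> f\<close>. The substitution \<open>z = x \<sigma>\<close> gives a fixed domain of
  integration, so that the value at \<open>x = 0\<close> and continuous dependence on parameters come for free.\<close>
definition radial_mean :: "real \<Rightarrow> (real \<Rightarrow> 'b::euclidean_space) \<Rightarrow> real \<Rightarrow> 'b" where
  "radial_mean \<kappa> f x = integral {0..1} (\<lambda>\<sigma>. \<sigma> powr (\<kappa> - 1) *\<^sub>R f (x * \<sigma>))"

definition radial_potential :: "real \<Rightarrow> (real \<Rightarrow> 'b::euclidean_space) \<Rightarrow> real \<Rightarrow> 'b" where
  "radial_potential \<kappa> f x = x *\<^sub>R integral {0..1} (\<lambda>\<theta>. radial_mean \<kappa> f (x * \<theta>))"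

lemma continuous_on_weight:
  fixes \<kappa> :: real
  assumes "\<kappa> > 1" "continuous_on A g" "\<And>y. y \<in> A \<Longrightarrow> g y \<ge> 0"
  shows "continuous_on A (\<lambda>y. g y powr (\<kappa> - 1))"
  using assms by (intro continuous_on_powr') auto

lemma continuous_radial_mean_param:
  fixes f :: "'a::topological_space \<Rightarrow> real \<Rightarrow> 'b::euclidean_space" and g :: "'a \<Rightarrow> real"
  assumes \<kappa>: "\<kappa> > 1" and f: "continuous_on UNIV (\<lambda>(t, x). f t x)" and g: "continuous_on UNIV g"
  shows "continuous_on UNIV (\<lambda>t. radial_mean \<kappa> (f t) (g t))"
proof -
  have "continuous_on (UNIV \<times> cbox 0 1) (\<lambda>(t, \<sigma>). \<sigma> powr (\<kappa> - 1) *\<^sub>R f t (g t * \<sigma>))"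
  proof -
    have 1: "continuous_on (UNIV \<times> cbox 0 1) (\<lambda>z::'a \<times> real. snd z powr (\<kappa> - 1))"
      by (rule continuous_on_weight[OF \<kappa>]) (auto intro: continuous_intros)
    have g': "continuous_on A (\<lambda>z::'a \<times> real. g (fst z))" for A
      by (rule continuous_on_compose2[OF g, of _ fst]) (auto intro: continuous_intros)
    have 2: "continuous_on (UNIV \<times> cbox 0 1)
        (\<lambda>z::'a \<times> real. (\<lambda>(t, x). f t x) (fst z, g (fst z) * snd z))"
      by (rule continuous_on_compose2[OF f]) (auto intro!: continuous_intros g')
    show ?thesis
      using continuous_on_scaleR[OF 1 2] by (simp add: case_prod_beta)
  qed
  from integral_continuous_on_param[OF this] show ?thesis
    by (simp add: radial_mean_def)
qed

lemma continuous_radial_mean: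
  fixes f :: "real \<Rightarrow> 'b::euclidean_space"
  assumes "\<kappa> > 1" and f: "continuous_on UNIV f"
  shows "continuous_on UNIV (radial_mean \<kappa> f)"
proof -
  have "continuous_on UNIV (\<lambda>z::real \<times> real. f (snd z))"
    by (rule continuous_on_compose2[OF f, of _ snd]) (auto intro: continuous_intros)
  then show ?thesis
    using continuous_radial_mean_param[of \<kappa> "\<lambda>t x. f x" "\<lambda>x. x"] assms
    by (simp add: case_prod_beta)
qed

lemma continuous_radial_potential_param:
  fixes f :: "'a::topological_space \<Rightarrow> real \<Rightarrow> 'b::euclidean_space" and g :: "'a \<Rightarrow> real"
  assumes \<kappa>: "\<kappa> > 1" and f: "continuous_on UNIV (\<lambda>(t, x). f t x)" and g: "continuous_on UNIV g"
  shows "continuous_on UNIV (\<lambda>t. radial_potential \<kappa> (f t) (g t))"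
proof -
  have f': "continuous_on UNIV (\<lambda>(z, x). f (fst z) x :: 'b)" for z :: "'a \<times> real"
    unfolding case_prod_beta
    by (rule continuous_on_compose2[OF f, of _ "\<lambda>w. (fst (fst w), snd w)", simplified])
       (auto intro!: continuous_intros)
  have g': "continuous_on UNIV (\<lambda>z. g (fst z) * snd z)"
    by (intro continuous_intros continuous_on_compose2[OF g, of _ fst]) auto
  have "continuous_on UNIV (\<lambda>z. radial_mean \<kappa> (f (fst z)) (g (fst z) * snd z))"
    by (rule continuous_radial_mean_param[OF \<kappa> f' g'])
  then have "continuous_on (UNIV \<times> cbox 0 1)
      (\<lambda>(t, \<theta>). radial_mean \<kappa> (f t) (g t * \<theta>))"
    unfolding case_prod_beta by (rule continuous_on_subset) auto
  from integral_continuous_on_param[OF this] show ?thesis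
    unfolding radial_potential_def
    by (intro continuous_on_scaleR g) simp
qed

lemma integral_unit_rescale:
  fixes g :: "real \<Rightarrow> 'b::euclidean_space"
  assumes "continuous_on {0..x} g" "x > 0"
  shows "x *\<^sub>R integral {0..1} (\<lambda>\<theta>. g (x * \<theta>)) = integral {0..x} g"
proof -
  have "(g has_integral integral {0..x} g) {0..x}"
    using assms(1) by (intro integrable_integral integrable_continuous_real)
  from has_integral_stretch_real[OF this, of x]
  have "((\<lambda>\<theta>. g (x * \<theta>)) has_integral (1 / \<bar>x\<bar>) *\<^sub>R integral {0..x} g) ((\<lambda>y. y / x) ` {0..x})"
    using assms by simp
  moreover have "(\<lambda>y. y / x) ` {0..x} = {0..1}"
  proof (intro equalityI subsetI)
    fix t assume "t \<in> {0..1::real}"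
    then show "t \<in> (\<lambda>y. y / x) ` {0..x}"
      using assms by (intro image_eqI[of _ _ "x * t"]) (auto simp: mult_left_le)
  qed (use assms in auto)
  ultimately have "integral {0..1} (\<lambda>\<theta>. g (x * \<theta>)) = (1 / \<bar>x\<bar>) *\<^sub>R integral {0..x} g"
    by (simp add: integral_unique)
  then show ?thesis using assms by simp
qed

lemma has_vector_derivative_integral_pos:
  fixes g :: "real \<Rightarrow> 'b::euclidean_space"
  assumes g: "continuous_on {0..} g" and "x > 0"
  shows "((\<lambda>y. integral {0..y} g) has_vector_derivative g x) (at x)"
proof -
  have "((\<lambda>y. integral {0..y} g) has_vector_derivative g x) (at x within {0..x+1})"
    by (rule integral_has_vector_derivative)
       (use assms in \<open>auto intro: continuous_on_subset\<close>)
  then show ?thesis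
    using assms at_within_interior[of x "{0..x+1}"] by (simp add: interior_atLeastAtMost_real)
qed

lemma radial_potential_has_derivative:
  fixes f :: "real \<Rightarrow> 'b::euclidean_space"
  assumes "\<kappa> > 1" "continuous_on UNIV f" "x > 0"
  shows "(radial_potential \<kappa> f has_vector_derivative radial_mean \<kappa> f x) (at x)"
proof -
  have c: "continuous_on UNIV (radial_mean \<kappa> f)"
    by (rule continuous_radial_mean) fact+
  have "((\<lambda>y. integral {0..y} (radial_mean \<kappa> f)) has_vector_derivative radial_mean \<kappa> f x) (at x)"
    by (rule has_vector_derivative_integral_pos)
       (use assms in \<open>auto intro: continuous_on_subset[OF c]\<close>)
  then show ?thesis
  proof (rule has_vector_derivative_transform_within_open)
    show "open {0::real<..}" "x \<in> {0<..}" using assms by auto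
    fix y :: real assume "y \<in> {0<..}"
    then show "integral {0..y} (radial_mean \<kappa> f) = radial_potential \<kappa> f y"
      unfolding radial_potential_def
      by (intro integral_unit_rescale[symmetric]) (auto intro: continuous_on_subset[OF c])
  qed
qed

text \<open>Undoing the substitution shows that \<open>x\<^sup>\<kappa>\<close> times the mean has derivative \<open>x\<^bsup>\<kappa>-1\<^esup> f(x)\<close>. Together with
  the derivative of the potential this says that the potential inverts \<open>w'' + \<kappa> w' / x\<close>.\<close>
lemma radial_mean_eq_integral:
  fixes f :: "real \<Rightarrow> 'b::euclidean_space"
  assumes "\<kappa> > 1" "continuous_on UNIV f" "x > 0"
  shows "x powr \<kappa> *\<^sub>R radial_mean \<kappa> f x = integral {0..x} (\<lambda>z. z powr (\<kappa> - 1) *\<^sub>R f z)"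
proof -
  have c: "continuous_on {0..x} (\<lambda>z. z powr (\<kappa> - 1) *\<^sub>R f z)"
    by (intro continuous_on_scaleR continuous_on_weight continuous_on_subset[OF assms(2)])
       (use assms in \<open>auto intro: continuous_intros\<close>)
  have "integral {0..x} (\<lambda>z. z powr (\<kappa> - 1) *\<^sub>R f z)
      = x *\<^sub>R integral {0..1} (\<lambda>\<sigma>. (x * \<sigma>) powr (\<kappa> - 1) *\<^sub>R f (x * \<sigma>))"
    by (rule integral_unit_rescale[OF c, symmetric]) fact
  also have "integral {0..1} (\<lambda>\<sigma>. (x * \<sigma>) powr (\<kappa> - 1) *\<^sub>R f (x * \<sigma>))
      = integral {0..1} (\<lambda>\<sigma>. x powr (\<kappa> - 1) *\<^sub>R (\<sigma> powr (\<kappa> - 1) *\<^sub>R f (x * \<sigma>)))"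
    using assms by (intro integral_cong) (simp add: powr_mult)
  also have "\<dots> = x powr (\<kappa> - 1) *\<^sub>R radial_mean \<kappa> f x"
    unfolding radial_mean_def by (rule integral_cmul)
  finally show ?thesis
    using assms by (simp add: powr_diff)
qed

lemma radial_mean_has_derivative:
  fixes f :: "real \<Rightarrow> 'b::euclidean_space"
  assumes "\<kappa> > 1" "continuous_on UNIV f" "x > 0"
  shows "(radial_mean \<kappa> f has_vector_derivative (1 / x) *\<^sub>R (f x - \<kappa> *\<^sub>R radial_mean \<kappa> f x)) (at x)"
proof -
  have c: "continuous_on {0..} (\<lambda>z. z powr (\<kappa> - 1) *\<^sub>R f z)"
    by (intro continuous_on_scaleR continuous_on_weight continuous_on_subset[OF assms(2)])
       (use assms in \<open>auto intro: continuous_intros\<close>)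
  have "((\<lambda>y. y powr (-\<kappa>)) has_real_derivative (-\<kappa> * x powr (-\<kappa> - 1))) (at x)"
    using assms by (auto intro!: derivative_eq_intros)
  from has_vector_derivative_scaleR[OF this has_vector_derivative_integral_pos[OF c \<open>x > 0\<close>]]
  have "((\<lambda>y. y powr (-\<kappa>) *\<^sub>R integral {0..y} (\<lambda>z. z powr (\<kappa> - 1) *\<^sub>R f z))
     has_vector_derivative
       x powr (-\<kappa>) *\<^sub>R (x powr (\<kappa> - 1) *\<^sub>R f x)
       + (-\<kappa> * x powr (-\<kappa> - 1)) *\<^sub>R integral {0..x} (\<lambda>z. z powr (\<kappa> - 1) *\<^sub>R f z)) (at x)" .
  also have "integral {0..x} (\<lambda>z. z powr (\<kappa> - 1) *\<^sub>R f z) = x powr \<kappa> *\<^sub>R radial_mean \<kappa> f x"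
    by (rule radial_mean_eq_integral[symmetric]) fact+
  also have "x powr (-\<kappa>) *\<^sub>R (x powr (\<kappa> - 1) *\<^sub>R f x)
       + (-\<kappa> * x powr (-\<kappa> - 1)) *\<^sub>R (x powr \<kappa> *\<^sub>R radial_mean \<kappa> f x)
     = (1 / x) *\<^sub>R (f x - \<kappa> *\<^sub>R radial_mean \<kappa> f x)"
  proof -
    have "x powr (-\<kappa>) * x powr (\<kappa> - 1) = 1 / x" "x powr (-\<kappa> - 1) * x powr \<kappa> = 1 / x"
      using assms by (simp_all add: powr_diff powr_minus_divide)
    then show ?thesis
      by (simp add: algebra_simps)
  qed
  finally show ?thesis
  proof (rule has_vector_derivative_transform_within_open)
    show "open {0::real<..}" "x \<in> {0<..}" using assms by auto
    fix y :: real assume "y \<in> {0<..}"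
    then show "y powr (-\<kappa>) *\<^sub>R integral {0..y} (\<lambda>z. z powr (\<kappa> - 1) *\<^sub>R f z) = radial_mean \<kappa> f y"
      using assms by (subst radial_mean_eq_integral[symmetric]) (auto simp flip: powr_add)
  qed
qed

lemma integrable_radial_mean:
  fixes f :: "real \<Rightarrow> 'b::euclidean_space"
  assumes "\<kappa> > 1" "continuous_on UNIV f"
  shows "(\<lambda>\<sigma>. \<sigma> powr (\<kappa> - 1) *\<^sub>R f (x * \<sigma>)) integrable_on {0..1}"
  by (intro integrable_continuous_real continuous_on_scaleR continuous_on_weight
      continuous_on_compose2[OF assms(2)]) (use assms in \<open>auto intro!: continuous_intros\<close>)

lemma norm_radial_mean_integrand:
  fixes f :: "real \<Rightarrow> 'b::euclidean_space"
  assumes "\<kappa> > 1" "\<sigma> \<in> {0..1}" "norm (f y) \<le> M"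
  shows "norm (\<sigma> powr (\<kappa> - 1) *\<^sub>R f y) \<le> M"
proof -
  have "\<sigma> powr (\<kappa> - 1) \<le> 1" using assms by (auto intro: powr_le1)
  then have "\<sigma> powr (\<kappa> - 1) * norm (f y) \<le> 1 * M"
    using assms by (intro mult_mono) auto
  then show ?thesis by simp
qed

lemma norm_radial_mean_le:
  fixes f :: "real \<Rightarrow> 'b::euclidean_space"
  assumes "\<kappa> > 1" "continuous_on UNIV f" "\<And>y. norm (f y) \<le> M"
  shows "norm (radial_mean \<kappa> f x) \<le> M"
proof -
  have "norm (radial_mean \<kappa> f x) \<le> integral {0..1} (\<lambda>_::real. M)"
    unfolding radial_mean_def
    by (rule integral_norm_bound_integral[OF integrable_radial_mean])
       (use assms in \<open>auto intro!: norm_radial_mean_integrand simp del: norm_scaleR\<close>)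
  then show ?thesis by simp
qed

lemma radial_potential_eq_integral:
  fixes f :: "real \<Rightarrow> 'b::euclidean_space"
  assumes "\<kappa> > 1" "continuous_on UNIV f" "x \<ge> 0"
  shows "radial_potential \<kappa> f x = integral {0..x} (radial_mean \<kappa> f)"
proof (cases "x = 0")
  case False
  then show ?thesis unfolding radial_potential_def
    by (intro integral_unit_rescale continuous_on_subset[OF continuous_radial_mean])
       (use assms in auto)
qed (simp add: radial_potential_def)

lemma radial_potential_diff:
  fixes f :: "real \<Rightarrow> 'b::euclidean_space"
  assumes "\<kappa> > 1" "continuous_on UNIV f" "0 \<le> x" "x \<le> y"
  shows "radial_potential \<kappa> f y - radial_potential \<kappa> f x = integral {x..y} (radial_mean \<kappa> f)"
proof -
  have "integral {0..x} (radial_mean \<kappa> f) + integral {x..y} (radial_mean \<kappa> f)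
      = integral {0..y} (radial_mean \<kappa> f)"
    using assms
    by (intro Henstock_Kurzweil_Integration.integral_combine integrable_continuous_real
        continuous_on_subset[OF continuous_radial_mean]) auto
  then show ?thesis
    using assms by (simp add: radial_potential_eq_integral algebra_simps)
qed

lemma norm_radial_potential_diff_le:
  fixes f :: "real \<Rightarrow> 'b::euclidean_space"
  assumes "\<kappa> > 1" "continuous_on UNIV f" "\<And>y. norm (f y) \<le> M" "0 \<le> x" "0 \<le> y"
  shows "norm (radial_potential \<kappa> f y - radial_potential \<kappa> f x) \<le> M * \<bar>y - x\<bar>"
proof -
  have *: "norm (radial_potential \<kappa> f y - radial_potential \<kappa> f x) \<le> M * (y - x)"
    if "0 \<le> x" "x \<le> y" for x y
  proof -
    have "norm (integral {x..y} (radial_mean \<kappa> f)) \<le> M * (y - x)"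
      by (rule integral_bound)
         (use assms that in \<open>auto intro: norm_radial_mean_le continuous_on_subset[OF continuous_radial_mean]\<close>)
    then show ?thesis
      using radial_potential_diff[OF assms(1,2) that] by simp
  qed
  show ?thesis
    using *[of x y] *[of y x] assms by (cases "x \<le> y") (auto simp: norm_minus_commute)
qed

lemma inner_radial_potential_mono:
  fixes f :: "real \<Rightarrow> 'b::euclidean_space"
  assumes "\<kappa> > 1" "continuous_on UNIV f" "\<And>y. f y \<bullet> b \<ge> 0" "0 \<le> x" "x \<le> y"
  shows "radial_potential \<kappa> f x \<bullet> b \<le> radial_potential \<kappa> f y \<bullet> b"
proof -
  have mean: "radial_mean \<kappa> f z \<bullet> b \<ge> 0" for z
  proof -
    have "radial_mean \<kappa> f z \<bullet> b
        = integral {0..1} ((\<lambda>v. v \<bullet> b) \<circ> (\<lambda>\<sigma>. \<sigma> powr (\<kappa> - 1) *\<^sub>R f (z * \<sigma>)))"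
      unfolding radial_mean_def
      by (rule integral_linear[OF integrable_radial_mean bounded_linear_inner_left, symmetric]) fact+
    also have "\<dots> \<ge> 0"
      using assms by (intro integral_nonneg integrable_linear integrable_radial_mean
          bounded_linear_inner_left) auto
    finally show ?thesis .
  qed
  have int: "radial_mean \<kappa> f integrable_on {x..y}"
    by (intro integrable_continuous_real continuous_on_subset[OF continuous_radial_mean]) (use assms in auto)
  have "(radial_potential \<kappa> f y - radial_potential \<kappa> f x) \<bullet> b
      = integral {x..y} ((\<lambda>v. v \<bullet> b) \<circ> radial_mean \<kappa> f)"
    unfolding radial_potential_diff[OF assms(1,2,4,5)]
    by (rule integral_linear[OF int bounded_linear_inner_left, symmetric])
  also have "\<dots> \<ge> 0"
    using mean by (intro integral_nonneg integrable_linear int bounded_linear_inner_left) auto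
  finally show ?thesis by (simp add: inner_diff_left)
qed

lemma radial_mean_cong:
  assumes "x \<ge> 0" "\<And>z. 0 \<le> z \<Longrightarrow> z \<le> x \<Longrightarrow> f z = g z"
  shows "radial_mean \<kappa> f x = radial_mean \<kappa> g x"
  unfolding radial_mean_def
  using assms by (intro integral_cong) (simp add: mult_left_le)

text \<open>Causality: the potential at \<open>x\<close> only depends on the source on \<open>[0, x]\<close>. This is what lets a delayed
  equation be solved by steps.\<close>
lemma radial_potential_cong:
  assumes "x \<ge> 0" "\<And>z. 0 \<le> z \<Longrightarrow> z \<le> x \<Longrightarrow> f z = g z"
  shows "radial_potential \<kappa> f x = radial_potential \<kappa> g x"
proof -
  have "radial_mean \<kappa> f (x * \<theta>) = radial_mean \<kappa> g (x * \<theta>)" if "\<theta> \<in> {0..1}" for \<theta>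
  proof (rule radial_mean_cong)
    fix z assume "0 \<le> z" "z \<le> x * \<theta>"
    moreover have "x * \<theta> \<le> x" using assms that by (auto intro: mult_left_le)
    ultimately show "f z = g z" using assms(2) by auto
  qed (use assms that in auto)
  then show ?thesis
    unfolding radial_potential_def by (intro arg_cong2[where f = scaleR] refl integral_cong)
qed

lemma radial_mean_tendsto:
  fixes f :: "nat \<Rightarrow> real \<Rightarrow> 'b::euclidean_space"
  assumes "\<kappa> > 1" "\<And>k. continuous_on UNIV (f k)" "\<And>k y. norm (f k y) \<le> M"
    and "\<And>z. z \<ge> 0 \<Longrightarrow> (\<lambda>k. f k z) \<longlonglongrightarrow> g z" "x \<ge> 0"
  shows "(\<lambda>k. radial_mean \<kappa> (f k) x) \<longlonglongrightarrow> radial_mean \<kappa> g x"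
  unfolding radial_mean_def
proof (rule dominated_convergence(2)[where h = "\<lambda>_. M"])
  show "(\<lambda>\<sigma>. \<sigma> powr (\<kappa> - 1) *\<^sub>R f k (x * \<sigma>)) integrable_on {0..1}" for k
    by (rule integrable_radial_mean) fact+
qed (use assms in \<open>auto intro!: tendsto_intros norm_radial_mean_integrand simp del: norm_scaleR\<close>)

lemma radial_potential_tendsto:
  fixes f :: "nat \<Rightarrow> real \<Rightarrow> 'b::euclidean_space"
  assumes "\<kappa> > 1" "\<And>k. continuous_on UNIV (f k)" "\<And>k y. norm (f k y) \<le> M"
    and "\<And>z. z \<ge> 0 \<Longrightarrow> (\<lambda>k. f k z) \<longlonglongrightarrow> g z" "x \<ge> 0"
  shows "(\<lambda>k. radial_potential \<kappa> (f k) x) \<longlonglongrightarrow> radial_potential \<kappa> g x"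
  unfolding radial_potential_def
proof (intro tendsto_scaleR tendsto_const dominated_convergence(2)[where h = "\<lambda>_. M"])
  show "(\<lambda>\<theta>. radial_mean \<kappa> (f k) (x * \<theta>)) integrable_on {0..1}" for k
    by (intro integrable_continuous_real continuous_on_compose2[OF continuous_radial_mean])
       (use assms in \<open>auto intro!: continuous_intros\<close>)
qed (use assms in \<open>auto intro!: norm_radial_mean_le radial_mean_tendsto\<close>)

section \<open>Retarded approximations and their limits\<close>

text \<open>Iterates for \<open>u(x) = q - potential of F(\<tau>, u(x - h))\<close>, where \<open>u\<close> is extended by \<open>u(0)\<close> to the left
  of \<open>0\<close>. The delay \<open>h > 0\<close> makes the iteration stationary on bounded intervals, so that
  continuity in \<open>\<tau>\<close> is inherited from finitely many integrations of a merely continuous \<open>F\<close>.\<close>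
primrec retarded_iterate ::
    "real \<Rightarrow> (real \<Rightarrow> 'b \<Rightarrow> 'b) \<Rightarrow> 'b::euclidean_space \<Rightarrow> real \<Rightarrow> nat \<Rightarrow> real \<Rightarrow> real \<Rightarrow> 'b" where
  "retarded_iterate \<kappa> F q h 0 \<tau> = (\<lambda>x. q)"
| "retarded_iterate \<kappa> F q h (Suc k) \<tau> = (\<lambda>x. q -
     radial_potential \<kappa> (\<lambda>z. F \<tau> (retarded_iterate \<kappa> F q h k \<tau> (max 0 (z - h)))) x)"

locale bounded_radial_ode =
  fixes \<kappa> M :: real and F :: "real \<Rightarrow> 'b::euclidean_space \<Rightarrow> 'b" and q :: "'b"
  assumes \<kappa>: "\<kappa> > 1"
    and continuous_F: "continuous_on UNIV (\<lambda>(\<tau>, p). F \<tau> p)"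
    and norm_F: "norm (F \<tau> p) \<le> M"
begin

abbreviation iter where "iter \<equiv> retarded_iterate \<kappa> F q"

lemma continuous_F_compose:
  assumes "continuous_on A f" "continuous_on A g"
  shows "continuous_on A (\<lambda>x. F (f x) (g x))"
  using continuous_on_compose2[OF continuous_F, of A "\<lambda>x. (f x, g x)"] assms
  by (auto intro: continuous_on_Pair)

lemma continuous_iter: "continuous_on UNIV (\<lambda>(\<tau>, x). iter h k \<tau> x)"
proof (induction k)
  case (Suc k)
  have "continuous_on UNIV (\<lambda>(w, z). F (fst w) (iter h k (fst w) (max 0 (z - h))))"
    unfolding case_prod_beta
    by (intro continuous_F_compose continuous_on_compose2[OF Suc,
          of _ "\<lambda>w. (fst (fst w), max 0 (snd w - h))", simplified])
       (auto intro!: continuous_intros)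
  moreover have "continuous_on UNIV (snd :: real \<times> real \<Rightarrow> real)"
    by (rule continuous_on_snd[OF continuous_on_id])
  ultimately show ?case
    using continuous_radial_potential_param[OF \<kappa>]
    by (auto simp: case_prod_beta intro!: continuous_on_diff continuous_on_const)
qed (simp add: case_prod_beta)

lemma continuous_iter_compose:
  assumes "continuous_on A f" "continuous_on A g"
  shows "continuous_on A (\<lambda>x. iter h k (f x) (g x))"
  using continuous_on_compose2[OF continuous_iter, of A "\<lambda>x. (f x, g x)"] assms
  by (auto intro: continuous_on_Pair)

lemma continuous_retarded_source:
  "continuous_on UNIV (\<lambda>z. F \<tau> (iter h k \<tau> (max 0 (z - h))))"
  by (intro continuous_F_compose continuous_iter_compose continuous_intros)

text \<open>Because of the delay, the values on \<open>[0, (k+1)h]\<close> only use those on \<open>[0, kh]\<close>.\<close>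

lemma iter_stable:
  assumes "h > 0" "0 \<le> x" "x \<le> real k * h"
  shows "iter h (Suc k) \<tau> x = iter h k \<tau> x"
  using assms(2,3)
proof (induction k arbitrary: x)
  case 0
  then show ?case by (simp add: radial_potential_def)
next
  case (Suc k)
  have "radial_potential \<kappa> (\<lambda>z. F \<tau> (iter h (Suc k) \<tau> (max 0 (z - h)))) x
      = radial_potential \<kappa> (\<lambda>z. F \<tau> (iter h k \<tau> (max 0 (z - h)))) x"
  proof (rule radial_potential_cong)
    fix z assume z: "0 \<le> z" "z \<le> x"
    then have "max 0 (z - h) \<le> real k * h"
      using Suc.prems assms(1) by (auto simp: algebra_simps)
    then show "F \<tau> (iter h (Suc k) \<tau> (max 0 (z - h))) = F \<tau> (iter h k \<tau> (max 0 (z - h)))"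
      using Suc.IH[of "max 0 (z - h)"] by simp
  qed fact
  then show ?case by (simp only: retarded_iterate.simps)
qed

text \<open>With delay \<open>1/(k+1)\<close> the iterate number \<open>(k+1)\<^sup>2\<close> is stationary on \<open>[0, k+1]\<close>. One more iteration
  puts the function in the form of a potential on the whole half-line.\<close>
definition approx :: "nat \<Rightarrow> real \<Rightarrow> real \<Rightarrow> 'b" where
  "approx k = iter (1 / real (Suc k)) (Suc (Suc k * Suc k))"

lemma approx_eq:
  assumes "0 \<le> x" "x \<le> real (Suc k)"
  shows "approx k \<tau> x = q - radial_potential \<kappa>
    (\<lambda>z. F \<tau> (approx k \<tau> (max 0 (z - 1 / real (Suc k))))) x"
proof -
  define h n where "h = 1 / real (Suc k)" and "n = Suc k * Suc k"
  have h: "h > 0" and nh: "real n * h = real (Suc k)"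
    unfolding h_def n_def of_nat_mult by (auto simp del: of_nat_Suc)
  have "radial_potential \<kappa> (\<lambda>z. F \<tau> (iter h n \<tau> (max 0 (z - h)))) x
      = radial_potential \<kappa> (\<lambda>z. F \<tau> (iter h (Suc n) \<tau> (max 0 (z - h)))) x"
  proof (rule radial_potential_cong)
    fix z assume "0 \<le> z" "z \<le> x"
    then show "F \<tau> (iter h n \<tau> (max 0 (z - h))) = F \<tau> (iter h (Suc n) \<tau> (max 0 (z - h)))"
      using iter_stable[OF h, of "max 0 (z - h)" n \<tau>] assms h by (auto simp: nh)
  qed fact
  then show ?thesis
    unfolding approx_def h_def[symmetric] n_def[symmetric] by (simp only: retarded_iterate.simps)
qed

lemma approx_unfold: "approx k \<tau> x = q - radial_potential \<kappa> (\<lambda>z. F \<tau>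
    (iter (1 / real (Suc k)) (Suc k * Suc k) \<tau> (max 0 (z - 1 / real (Suc k))))) x"
  unfolding approx_def by (simp only: retarded_iterate.simps)

lemma approx_continuous: "continuous_on UNIV (\<lambda>\<tau>. approx k \<tau> x)"
  unfolding approx_def by (intro continuous_iter_compose continuous_intros)

lemma approx_0 [simp]: "approx k \<tau> 0 = q"
  by (simp add: approx_def radial_potential_def)

lemma approx_lipschitz:
  assumes "0 \<le> x" "0 \<le> y"
  shows "norm (approx k \<tau> y - approx k \<tau> x) \<le> M * \<bar>y - x\<bar>"
proof -
  have *: "norm ((q - a) - (q - b)) = norm (b - a)" for a b by simp
  show ?thesis
    unfolding approx_unfold *
    using norm_radial_potential_diff_le[OF \<kappa> continuous_retarded_source norm_F assms(2,1)]
    by (simp only: abs_minus_commute)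
qed

lemma approx_antimono:
  assumes "\<And>p. F \<tau> p \<bullet> b \<ge> 0" "0 \<le> x" "x \<le> y"
  shows "approx k \<tau> y \<bullet> b \<le> approx k \<tau> x \<bullet> b"
  using inner_radial_potential_mono[OF \<kappa> continuous_retarded_source _ assms(2,3)] assms(1)
  unfolding approx_unfold by (simp only: inner_diff_left diff_left_mono)

lemma M_nonneg: "M \<ge> 0"
  using norm_F[of undefined undefined] norm_ge_zero order_trans by blast

text \<open>A diagonal sequence converges at the rationals, and then everywhere by the uniform Lipschitz
  bound.\<close>
lemma approx_subsequence_pointwise:
  fixes \<rho> :: "nat \<Rightarrow> nat" and \<tau> :: "nat \<Rightarrow> real"
  obtains r where "strict_mono (r :: nat \<Rightarrow> nat)"
    "\<And>x. x \<ge> 0 \<Longrightarrow> convergent (\<lambda>k. approx (\<rho> (r k)) (\<tau> (r k)) x)"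
proof -
  let ?A = "\<lambda>k. approx (\<rho> k) (\<tau> k)"
  let ?S = "\<rat> \<inter> {0::real..}"
  \<comment> \<open>The approximations grow at most linearly; dividing by \<open>1 + x\<close> gives one bound for all points.\<close>
  have bd: "norm (?A k x /\<^sub>R (1 + x)) \<le> norm q + M" if "x \<in> ?S" for k x
  proof -
    have "norm (?A k x - ?A k 0) \<le> M * \<bar>x - 0\<bar>"
      by (rule approx_lipschitz) (use that in auto)
    then have "norm (?A k x) \<le> norm q + M * x"
      using norm_triangle_sub[of "?A k x" q] that by simp
    also have "\<dots> \<le> (norm q + M) * (1 + x)"
      using that M_nonneg by (simp add: algebra_simps)
    finally show ?thesis using that by (simp add: divide_simps mult.commute)
  qed
  have "countable ?S" by (intro countable_Int1 countable_rat)
  from function_convergent_subsequence[of ?S "\<lambda>k x. ?A k x /\<^sub>R (1 + x)", OF this bd]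
  obtain r where r: "strict_mono r" and
    conv: "\<And>x. x \<in> ?S \<Longrightarrow> \<exists>l. (\<lambda>k. ?A (r k) x /\<^sub>R (1 + x)) \<longlonglongrightarrow> l"
    by metis
  have rat: "Cauchy (\<lambda>k. ?A (r k) x)" if x: "x \<in> ?S" for x
  proof -
    obtain l where "(\<lambda>k. ?A (r k) x /\<^sub>R (1 + x)) \<longlonglongrightarrow> l"
      using conv[OF x] by blast
    from tendsto_scaleR[OF tendsto_const[of "1 + x"] this]
    have "(\<lambda>k. ?A (r k) x) \<longlonglongrightarrow> (1 + x) *\<^sub>R l" using x by simp
    then show ?thesis by (rule LIMSEQ_imp_Cauchy)
  qed
  have "Cauchy (\<lambda>k. ?A (r k) x)" if x: "x \<ge> 0" for x
  proof (rule CauchyI)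
    fix e :: real assume e: "e > 0"
    define d where "d = e / (4 * (M + 1))"
    have d: "d > 0" using e M_nonneg by (simp add: d_def)
    obtain y where y: "y \<in> \<rat>" "x < y" "y < x + d"
      using Rats_dense_in_real[of x "x + d"] d by auto
    have "M * d \<le> (M + 1) * d" using d by simp
    also have "\<dots> = e / 4" using M_nonneg by (simp add: d_def divide_simps)
    finally have Md: "M * d \<le> e / 4" .
    have lip: "norm (?A k x - ?A k y) \<le> e / 4" for k
    proof -
      have "norm (?A k x - ?A k y) \<le> M * \<bar>x - y\<bar>"
        by (rule approx_lipschitz) (use x y in auto)
      also have "\<dots> \<le> M * d" using y M_nonneg by (intro mult_left_mono) auto
      finally show ?thesis using Md by simp
    qed
    obtain N where N: "\<And>m n. m \<ge> N \<Longrightarrow> n \<ge> N \<Longrightarrow> norm (?A (r m) y - ?A (r n) y) < e / 2"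
      using CauchyD[OF rat[of y], of "e / 2"] x y e by auto
    have "norm (?A (r m) x - ?A (r n) x) < e" if "m \<ge> N" "n \<ge> N" for m n
    proof -
      have "?A (r m) x - ?A (r n) x = (?A (r m) x - ?A (r m) y)
          + (?A (r m) y - ?A (r n) y) - (?A (r n) x - ?A (r n) y)" by simp
      also have "norm \<dots> \<le> norm (?A (r m) x - ?A (r m) y)
          + norm (?A (r m) y - ?A (r n) y) + norm (?A (r n) x - ?A (r n) y)"
        using norm_triangle_ineq4 norm_triangle_ineq by (smt (verit))
      finally show ?thesis using lip[of "r m"] lip[of "r n"] N[OF that] by linarith
    qed
    then show "\<exists>N. \<forall>m\<ge>N. \<forall>n\<ge>N. norm (?A (r m) x - ?A (r n) x) < e" by blast
  qed
  then show thesis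
    using that[OF r] by (simp add: Cauchy_convergent_iff)
qed

text \<open>Peano's theorem together with compactness in the parameter: limits of delayed solutions solve the
  equation without delay, because the delay tends to \<open>0\<close> and the approximations are uniformly
  Lipschitz. The extra sequence \<open>\<rho>\<close> permits successive extractions of subsequences.\<close>
lemma approx_limit:
  fixes \<rho> :: "nat \<Rightarrow> nat" and \<tau> :: "nat \<Rightarrow> real"
  assumes \<rho>: "strict_mono \<rho>" and \<tau>: "\<And>k. \<tau> k \<in> {0..1}"
  obtains r t p where "strict_mono (r :: nat \<Rightarrow> nat)" "t \<in> {0..1}" "(\<lambda>k. \<tau> (r k)) \<longlonglongrightarrow> t"
    "continuous_on UNIV p"
    "\<forall>x\<ge>0. p x = q - radial_potential \<kappa> (\<lambda>z. F t (p z)) x"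
    "\<forall>x\<ge>0. (\<lambda>k. approx (\<rho> (r k)) (\<tau> (r k)) x) \<longlonglongrightarrow> p x"
proof -
  obtain t r1 where t: "t \<in> {0..1}" and r1: "strict_mono (r1::nat\<Rightarrow>nat)" and lim: "(\<tau> \<circ> r1) \<longlonglongrightarrow> t"
    using compact_Icc[of 0 "1::real"] \<tau> unfolding compact_def by metis
  obtain r2 where r2: "strict_mono (r2 :: nat \<Rightarrow> nat)" and
    conv: "\<And>x. x \<ge> 0 \<Longrightarrow> convergent (\<lambda>k. approx (\<rho> (r1 (r2 k))) (\<tau> (r1 (r2 k))) x)"
    using approx_subsequence_pointwise[of "\<lambda>k. \<rho> (r1 k)" "\<lambda>k. \<tau> (r1 k)"] by metis
  define r where "r = r1 \<circ> r2"
  define n where "n k = \<rho> (r k)" for k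
  define s where "s k = \<tau> (r k)" for k
  \<comment> \<open>The constant extension to the left of \<open>0\<close> makes the limit continuous on the whole line.\<close>
  define p where "p x = lim (\<lambda>k. approx (n k) (s k) (max 0 x))" for x
  have r: "strict_mono r" unfolding r_def using r1 r2 by (rule strict_mono_o)
  have n: "strict_mono n" unfolding n_def using strict_mono_o[OF \<rho> r] by (simp add: o_def)
  have s: "s \<longlonglongrightarrow> t"
    using LIMSEQ_subseq_LIMSEQ[OF lim r2] by (simp add: s_def[abs_def] r_def o_def)
  have p: "(\<lambda>k. approx (n k) (s k) (max 0 x)) \<longlonglongrightarrow> p x" for x
    using conv[of "max 0 x"] unfolding p_def n_def s_def r_def by (simp add: convergent_LIMSEQ_iff)
  have p': "(\<lambda>k. approx (n k) (s k) x) \<longlonglongrightarrow> p x" if "x \<ge> 0" for x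
    using p[of x] that by simp
  have lip: "norm (p y - p x) \<le> M * \<bar>y - x\<bar>" for x y
  proof (rule Lim_bounded)
    show "(\<lambda>k. norm (approx (n k) (s k) (max 0 y) - approx (n k) (s k) (max 0 x))) \<longlonglongrightarrow> norm (p y - p x)"
      by (intro tendsto_intros p)
    have "M * \<bar>max 0 y - max 0 x\<bar> \<le> M * \<bar>y - x\<bar>"
      by (intro mult_left_mono M_nonneg) auto
    then show "\<forall>k\<ge>0. norm (approx (n k) (s k) (max 0 y) - approx (n k) (s k) (max 0 x)) \<le> M * \<bar>y - x\<bar>"
      using approx_lipschitz[of "max 0 x" "max 0 y"] by (smt (verit))
  qed
  have contp: "continuous_on UNIV p"
  proof (rule continuous_on_iff[THEN iffD2], intro ballI allI impI)
    fix x e :: real assume e: "e > 0"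
    have "dist (p y) (p x) < e" if "dist y x < e / (M + 1)" for y
    proof -
      have "dist (p y) (p x) \<le> (M + 1) * \<bar>y - x\<bar>"
        using lip[of y x] by (simp add: dist_norm algebra_simps)
      also have "\<dots> < e" using that M_nonneg by (simp add: dist_norm field_simps)
      finally show ?thesis .
    qed
    then show "\<exists>d>0. \<forall>y\<in>UNIV. dist y x < d \<longrightarrow> dist (p y) (p x) < e"
      using e M_nonneg by (intro exI[of _ "e / (M + 1)"]) auto
  qed
  have eq: "p x = q - radial_potential \<kappa> (\<lambda>z. F t (p z)) x" if x: "x \<ge> 0" for x
  proof -
    define f where "f k z = F (s k) (approx (n k) (s k) (max 0 (z - 1 / real (Suc (n k)))))" for k z
    have "(\<lambda>k. radial_potential \<kappa> (f k) x) \<longlonglongrightarrow> radial_potential \<kappa> (\<lambda>z. F t (p z)) x"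
    proof (rule radial_potential_tendsto[OF \<kappa> _ _ _ x])
      show "continuous_on UNIV (f k)" for k
        unfolding f_def approx_def by (intro continuous_F_compose continuous_iter_compose continuous_intros)
      show "norm (f k z) \<le> M" for k z unfolding f_def by (rule norm_F)
      fix z :: real assume z: "z \<ge> 0"
      have h: "(\<lambda>k. 1 / real (Suc (n k))) \<longlonglongrightarrow> 0"
        using LIMSEQ_subseq_LIMSEQ[OF LIMSEQ_inverse_real_of_nat n] by (simp add: o_def inverse_eq_divide)
      have "(\<lambda>k. approx (n k) (s k) (max 0 (z - 1 / real (Suc (n k)))) - approx (n k) (s k) z) \<longlonglongrightarrow> 0"
      proof (rule Lim_null_comparison)
        show "(\<lambda>k. M * (1 / real (Suc (n k)))) \<longlonglongrightarrow> 0"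
          using tendsto_mult[OF tendsto_const[of M] h] by simp
        show "\<forall>\<^sub>F k in sequentially. norm (approx (n k) (s k) (max 0 (z - 1 / real (Suc (n k))))
            - approx (n k) (s k) z) \<le> M * (1 / real (Suc (n k)))"
        proof (intro always_eventually allI)
          fix k
          have "norm (approx (n k) (s k) (max 0 (z - 1 / real (Suc (n k)))) - approx (n k) (s k) z)
             \<le> M * \<bar>max 0 (z - 1 / real (Suc (n k))) - z\<bar>"
            by (rule approx_lipschitz) (use z in auto)
          also have "\<dots> \<le> M * (1 / real (Suc (n k)))"
          proof (intro mult_left_mono M_nonneg)
            have "1 / real (Suc (n k)) \<ge> 0" by simp
            then show "\<bar>max 0 (z - 1 / real (Suc (n k))) - z\<bar> \<le> 1 / real (Suc (n k))"
              using z by linarith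
          qed
          finally show "norm (approx (n k) (s k) (max 0 (z - 1 / real (Suc (n k))))
            - approx (n k) (s k) z) \<le> M * (1 / real (Suc (n k)))" .
        qed
      qed
      from tendsto_add[OF this p'[OF z]]
      have "(\<lambda>k. approx (n k) (s k) (max 0 (z - 1 / real (Suc (n k))))) \<longlonglongrightarrow> p z" by simp
      from continuous_on_tendsto_compose[OF continuous_F tendsto_Pair[OF s this]]
      show "(\<lambda>k. f k z) \<longlonglongrightarrow> F t (p z)" unfolding f_def by simp
    qed
    then have "(\<lambda>k. q - radial_potential \<kappa> (f k) x) \<longlonglongrightarrow> q - radial_potential \<kappa> (\<lambda>z. F t (p z)) x"
      by (intro tendsto_intros)
    moreover have "\<forall>\<^sub>F k in sequentially. q - radial_potential \<kappa> (f k) x = approx (n k) (s k) x"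
      using eventually_ge_at_top[of "nat \<lceil>x\<rceil>"]
    proof eventually_elim
      case (elim k)
      have "k \<le> n k" by (rule seq_suble[OF n])
      then have "x \<le> real (Suc (n k))" using elim by linarith
      from approx_eq[OF x this] show ?case unfolding f_def by simp
    qed
    ultimately have "(\<lambda>k. approx (n k) (s k) x) \<longlonglongrightarrow> q - radial_potential \<kappa> (\<lambda>z. F t (p z)) x"
      by (rule Lim_transform_eventually)
    from LIMSEQ_unique[OF p'[OF x] this] show ?thesis .
  qed
  show thesis
    by (rule that[OF r t _ contp]) (use eq s p' in \<open>auto simp: n_def s_def[abs_def]\<close>)
qed

end

section \<open>The radial Poisson equation\<close>

text \<open>First-order form, with \<open>P = -u'\<close>, of \<open>(x\<^sup>\<kappa> u')' = - x\<^bsup>\<kappa>-1\<^esup> f\<close>. Continuity of \<open>P\<close> at the origin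
  singles out the regular solutions.\<close>
definition radial_poisson ::
    "real \<Rightarrow> (real \<Rightarrow> real) \<Rightarrow> (real \<Rightarrow> real) \<Rightarrow> (real \<Rightarrow> real) \<Rightarrow> bool" where
  "radial_poisson \<kappa> f u P \<longleftrightarrow> continuous_on {0..} u \<and> continuous_on {0..} P \<and>
     (\<forall>x>0. (u has_real_derivative - P x) (at x) \<and>
             (P has_real_derivative (f x - \<kappa> * P x) / x) (at x))"

lemma antimono_except_finite:
  fixes f :: "real \<Rightarrow> real"
  assumes "a \<le> b" "finite S" "continuous_on {a..b} f"
    and der: "\<And>x. a < x \<Longrightarrow> x < b \<Longrightarrow> x \<notin> S \<Longrightarrow> \<exists>D. (f has_real_derivative D) (at x) \<and> D \<le> 0"
  shows "f b \<le> f a"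
proof -
  obtain D where D: "\<And>x. a < x \<Longrightarrow> x < b \<Longrightarrow> x \<notin> S \<Longrightarrow> (f has_real_derivative D x) (at x) \<and> D x \<le> 0"
    using der by metis
  define D' where "D' x = (if x \<in> S \<union> {a, b} then 0 else D x)" for x
  have "(D' has_integral (f b - f a)) {a..b}"
    by (rule fundamental_theorem_of_calculus_interior_strong[OF assms(2)])
       (use assms D in \<open>auto simp: D'_def simp flip: has_real_derivative_iff_has_vector_derivative\<close>)
  from has_integral_neg[OF this] have "0 \<le> - (f b - f a)"
    by (rule has_integral_nonneg) (use D in \<open>auto simp: D'_def\<close>)
  then show ?thesis by simp
qed

lemma radial_poissonD:
  assumes "radial_poisson \<kappa> f u P"
  shows "continuous_on {0..} u" "continuous_on {0..} P"
    "\<And>x. x > 0 \<Longrightarrow> (u has_real_derivative - P x) (at x)"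
    "\<And>x. x > 0 \<Longrightarrow> (P has_real_derivative (f x - \<kappa> * P x) / x) (at x)"
  using assms by (auto simp: radial_poisson_def)

lemma continuous_on_powr_0:
  fixes \<kappa> :: real
  assumes "\<kappa> > 0"
  shows "continuous_on {0..} (\<lambda>x. x powr \<kappa>)"
  by (rule continuous_on_powr') (use assms in \<open>auto intro: continuous_intros\<close>)

text \<open>The constant \<open>c\<close> compares \<open>u\<close> with the explicit solution of slope \<open>P = c\<close> and source \<open>\<kappa> c\<close>.\<close>
lemma radial_flux_derivative:
  assumes "radial_poisson \<kappa> f u P" "x > 0"
  shows "((\<lambda>x. x powr \<kappa> * (P x - c)) has_real_derivative x powr (\<kappa> - 1) * (f x - \<kappa> * c)) (at x)"
proof -
  have "x powr \<kappa> = x * x powr (\<kappa> - 1)"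
    using assms by (simp add: powr_diff)
  then have "\<kappa> * x powr (\<kappa> - 1) * (P x - c) + (f x - \<kappa> * P x) / x * x powr \<kappa>
      = x powr (\<kappa> - 1) * (f x - \<kappa> * c)"
    using assms by (simp add: field_simps)
  moreover have "((\<lambda>x. x powr \<kappa> * (P x - c)) has_real_derivative
      \<kappa> * x powr (\<kappa> - 1) * (P x - c) + (f x - \<kappa> * P x) / x * x powr \<kappa>) (at x)"
    using assms by (auto intro!: derivative_eq_intros radial_poissonD(4)[OF assms(1)])
  ultimately show ?thesis by simp
qed

lemma continuous_radial_flux:
  assumes "radial_poisson \<kappa> f u P" "\<kappa> > 0"
  shows "continuous_on {0..} (\<lambda>x. x powr \<kappa> * (P x - c))"
  by (intro continuous_intros continuous_on_powr_0 radial_poissonD(2)[OF assms(1)]) fact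

lemma radial_poisson_gradient_ge:
  assumes "radial_poisson \<kappa> f u P" "\<kappa> > 0" "x > 0"
    and f: "\<And>y. 0 < y \<Longrightarrow> y < x \<Longrightarrow> f y \<ge> c"
  shows "P x \<ge> c / \<kappa>"
proof -
  have "0 powr \<kappa> * (P 0 - c / \<kappa>) \<le> x powr \<kappa> * (P x - c / \<kappa>)"
  proof (rule DERIV_nonneg_imp_increasing_open[of 0 x])
    fix y assume y: "0 < y" "y < x"
    show "\<exists>D. ((\<lambda>x. x powr \<kappa> * (P x - c / \<kappa>)) has_real_derivative D) (at y) \<and> 0 \<le> D"
      by (rule exI, rule conjI, rule radial_flux_derivative[OF assms(1)])
         (use y f[OF y] assms(2) in auto)
  next
    show "continuous_on {0..x} (\<lambda>x. x powr \<kappa> * (P x - c / \<kappa>))"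
      by (rule continuous_on_subset[OF continuous_radial_flux[OF assms(1,2)]]) auto
  qed (use assms in auto)
  then show ?thesis using assms by (simp add: zero_le_mult_iff)
qed

lemma radial_poisson_gradient_pos:
  assumes "radial_poisson \<kappa> f u P" "\<kappa> > 0" "x > 0"
    and f: "\<And>y. 0 < y \<Longrightarrow> y < x \<Longrightarrow> f y > 0"
  shows "P x > 0"
proof -
  have "0 powr \<kappa> * (P 0 - 0) < x powr \<kappa> * (P x - 0)"
  proof (rule DERIV_pos_imp_increasing_open[of 0 x])
    fix y assume y: "0 < y" "y < x"
    show "\<exists>D. ((\<lambda>x. x powr \<kappa> * (P x - 0)) has_real_derivative D) (at y) \<and> 0 < D"
      by (rule exI, rule conjI, rule radial_flux_derivative[OF assms(1)])
         (use y f[OF y] assms(2) in auto)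
  next
    show "continuous_on {0..x} (\<lambda>x. x powr \<kappa> * (P x - 0))"
      by (rule continuous_on_subset[OF continuous_radial_flux[OF assms(1,2)]]) auto
  qed (use assms in auto)
  then show ?thesis using assms by (simp add: zero_less_mult_iff)
qed

lemma radial_poisson_antimono:
  assumes "radial_poisson \<kappa> f u P" "\<kappa> > 0" "0 \<le> x" "x \<le> y"
    and f: "\<And>z. 0 < z \<Longrightarrow> z < y \<Longrightarrow> f z \<ge> 0"
  shows "u y \<le> u x"
proof (rule DERIV_nonpos_imp_decreasing_open[of x y])
  fix z assume z: "x < z" "z < y"
  have "P z \<ge> 0 / \<kappa>"
    by (rule radial_poisson_gradient_ge[OF assms(1,2)]) (use z assms f in auto)
  then show "\<exists>D. (u has_real_derivative D) (at z) \<and> D \<le> 0"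
    using radial_poissonD(3)[OF assms(1), of z] z assms by auto
next
  show "continuous_on {x..y} u"
    by (rule continuous_on_subset[OF radial_poissonD(1)[OF assms(1)]]) (use assms in auto)
qed (use assms in auto)

text \<open>A solution and its negative are both nonincreasing when the source vanishes.\<close>
lemma radial_poisson_eq_const:
  assumes "radial_poisson \<kappa> (\<lambda>_. 0) u P" "\<kappa> > 0" "x \<ge> 0"
  shows "u x = u 0"
proof (rule antisym)
  show "u x \<le> u 0"
    by (rule radial_poisson_antimono[OF assms(1,2)]) (use assms in auto)
  have "radial_poisson \<kappa> (\<lambda>_. 0) (\<lambda>x. - u x) (\<lambda>x. - P x)"
    using assms(1) unfolding radial_poisson_def
    by (auto intro!: continuous_intros derivative_eq_intros)
  from radial_poisson_antimono[OF this assms(2), of 0 x] assms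
  show "u 0 \<le> u x" by simp
qed

text \<open>For a nonnegative source \<open>x P - (\<kappa>-1) u\<close> is nondecreasing. This is how the logarithmic slope
  \<open>X = x P / u\<close> is compared with the level \<open>\<kappa> - 1\<close>, the slope of the singular harmonic function
  \<open>x\<^bsup>1-\<kappa>\<^esup>\<close>.\<close>

lemma radial_slope_derivative:
  assumes "radial_poisson \<kappa> f u P" "x > 0"
  shows "((\<lambda>x. x * P x - (\<kappa> - 1) * u x) has_real_derivative f x) (at x)"
  using assms
  by (auto intro!: derivative_eq_intros radial_poissonD(3,4)[OF assms(1)] simp: field_simps)

lemma radial_poisson_component:
  fixes p :: "real \<Rightarrow> real \<times> real"
  assumes "\<kappa> > 1" "continuous_on UNIV f" "continuous_on UNIV p"
    and eq: "\<And>x. x \<ge> 0 \<Longrightarrow> p x = q - radial_potential \<kappa> f x"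
    and lin: "bounded_linear \<pi>"
  shows "radial_poisson \<kappa> (\<lambda>x. \<pi> (f x)) (\<lambda>x. \<pi> (p x) :: real) (\<lambda>x. \<pi> (radial_mean \<kappa> f x))"
  unfolding radial_poisson_def
proof (intro conjI allI impI)
  show "continuous_on {0..} (\<lambda>x. \<pi> (p x))" "continuous_on {0..} (\<lambda>x. \<pi> (radial_mean \<kappa> f x))"
    using continuous_radial_mean[OF assms(1,2)] assms(3)
    by (auto intro!: bounded_linear.continuous_on[OF lin] intro: continuous_on_subset)
  fix x :: real assume x: "x > 0"
  have "(p has_vector_derivative - radial_mean \<kappa> f x) (at x)"
  proof (rule has_vector_derivative_transform_within_open)
    show "((\<lambda>x. q - radial_potential \<kappa> f x) has_vector_derivative - radial_mean \<kappa> f x) (at x)"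
      using has_vector_derivative_diff[OF has_vector_derivative_const
          radial_potential_has_derivative[OF assms(1,2) x]] by simp
    show "open {0::real<..}" "x \<in> {0<..}" using x by auto
  qed (use eq in auto)
  from bounded_linear.has_vector_derivative[OF lin this]
  show "((\<lambda>x. \<pi> (p x)) has_real_derivative - \<pi> (radial_mean \<kappa> f x)) (at x)"
    by (simp add: has_real_derivative_iff_has_vector_derivative linear_neg bounded_linear.linear[OF lin])
  from bounded_linear.has_vector_derivative[OF lin radial_mean_has_derivative[OF assms(1,2) x]]
  show "((\<lambda>x. \<pi> (radial_mean \<kappa> f x)) has_real_derivative
      (\<pi> (f x) - \<kappa> * \<pi> (radial_mean \<kappa> f x)) / x) (at x)"
    by (simp add: has_real_derivative_iff_has_vector_derivative linear_diff linear_scale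
        bounded_linear.linear[OF lin] diff_divide_distrib)
qed

section \<open>Pohozaev identities\<close>

text \<open>Truncating at \<open>0\<close> lets solutions continue past their zeros. With the roles of \<open>u\<close> and \<open>v\<close>
  exchanged, \<open>power_source s \<mu> v u\<close> is the source of the second equation, which makes the
  symmetry of the system syntactic.\<close>
definition power_source :: "real \<Rightarrow> real \<Rightarrow> (real \<Rightarrow> real) \<Rightarrow> (real \<Rightarrow> real) \<Rightarrow> real \<Rightarrow> real" where
  "power_source s \<delta> u v x = max 0 (u x) powr s * max 0 (v x) powr \<delta>"

lemma power_source_nonneg [simp]: "power_source s \<delta> u v x \<ge> 0"
  by (simp add: power_source_def)

lemma power_source_pos: "u x > 0 \<Longrightarrow> v x > 0 \<Longrightarrow> power_source s \<delta> u v x > 0"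
  by (simp add: power_source_def)

lemma continuous_power_source:
  assumes "s > 0" "\<delta> > 0" "continuous_on A u" "continuous_on A v"
  shows "continuous_on A (power_source s \<delta> u v)"
  unfolding power_source_def[abs_def]
  by (intro continuous_on_mult continuous_on_powr' continuous_on_max continuous_on_const)
     (use assms in auto)

lemma power_source_derivative:
  assumes "(u has_real_derivative - P) (at x)" "(v has_real_derivative - Q) (at x)" "u x > 0" "v x > 0"
  shows "(power_source s \<delta> u v has_real_derivative
     - power_source s \<delta> u v x * (s * P / u x + \<delta> * Q / v x)) (at x)"
proof -
  have "\<forall>\<^sub>F y in nhds x. u y > 0" "\<forall>\<^sub>F y in nhds x. v y > 0"
    using assms(1,2)[THEN DERIV_isCont] assms(3,4)
    by (auto intro!: order_tendstoD(1) simp: isCont_def tendsto_at_iff_tendsto_nhds)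
  then have ev: "\<forall>\<^sub>F y in nhds x. power_source s \<delta> u v y = u y powr s * v y powr \<delta>"
    by eventually_elim (simp add: power_source_def)
  have "u x powr (s - 1) = u x powr s / u x" "v x powr (\<delta> - 1) = v x powr \<delta> / v x"
    using assms by (auto simp: powr_diff)
  moreover have "((\<lambda>y. u y powr s * v y powr \<delta>) has_real_derivative
     (s * u x powr (s - 1) * (- P)) * v x powr \<delta> + (\<delta> * v x powr (\<delta> - 1) * (- Q)) * u x powr s) (at x)"
    using assms by (auto intro!: derivative_eq_intros)
  ultimately have "((\<lambda>y. u y powr s * v y powr \<delta>) has_real_derivative
     - (u x powr s * v x powr \<delta>) * (s * P / u x + \<delta> * Q / v x)) (at x)"
    by (simp add: algebra_simps)
  moreover have "power_source s \<delta> u v x = u x powr s * v x powr \<delta>"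
    using assms by (simp add: power_source_def)
  ultimately show ?thesis
    using DERIV_cong_ev[OF refl ev refl] by simp
qed

text \<open>The Pohozaev energies below are linear combinations of three kinds of products; their
  derivatives are computed once here.\<close>
lemma flux_product_derivative:
  assumes "radial_poisson \<kappa> f u P" "(v has_real_derivative - Q) (at x)" "x > 0"
  shows "((\<lambda>x. x powr \<kappa> * (P x * v x)) has_real_derivative
    x powr \<kappa> * (f x * v x / x - P x * Q)) (at x)"
proof -
  have *: "x powr (\<kappa> - 1) = x powr \<kappa> / x" using assms by (simp add: powr_diff)
  show ?thesis
    using assms(2,3) radial_poissonD(4)[OF assms(1,3)]
    by (auto intro!: derivative_eq_intros simp: * field_simps)
qed

lemma gradient_product_derivative:
  assumes "radial_poisson \<kappa> f u P" "radial_poisson \<kappa> h v Q" "x > 0"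
  shows "((\<lambda>x. x powr \<kappa> * (x * P x * Q x)) has_real_derivative
    x powr \<kappa> * (f x * Q x + P x * h x - (\<kappa> - 1) * P x * Q x)) (at x)"
proof -
  have *: "x powr (\<kappa> - 1) = x powr \<kappa> / x" using assms by (simp add: powr_diff)
  show ?thesis
    using assms(3) radial_poissonD(4)[OF assms(1,3)] radial_poissonD(4)[OF assms(2,3)]
    by (auto intro!: derivative_eq_intros simp: * field_simps)
qed

lemma source_product_derivative:
  assumes "(u has_real_derivative - P) (at x)" "(f has_real_derivative - f x * w) (at x)" "x > 0"
  shows "((\<lambda>x. x powr \<kappa> * (u x * f x)) has_real_derivative
    x powr \<kappa> * (\<kappa> * u x * f x / x - f x * P - u x * f x * w)) (at x)"
proof -
  have *: "x powr (\<kappa> - 1) = x powr \<kappa> / x" using assms by (simp add: powr_diff)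
  show ?thesis
    using assms by (auto intro!: derivative_eq_intros simp: * field_simps)
qed

text \<open>The energies are only differentiable inside \<open>(0, L)\<close>, and some of their terms, such as
  \<open>x P / u\<close>, have no value at \<open>L\<close>. Comparing with continuous bounds \<open>W\<close> and \<open>U\<close> avoids computing their
  limits.\<close>
lemma antimono_boundary_values:
  fixes \<Psi> U W :: "real \<Rightarrow> real"
  assumes "L > 0"
    and anti: "\<And>x y. 0 < x \<Longrightarrow> x \<le> y \<Longrightarrow> y < L \<Longrightarrow> \<Psi> y \<le> \<Psi> x"
    and U: "continuous_on {0..L} U" "U 0 = 0" "\<And>x. 0 < x \<Longrightarrow> x < L \<Longrightarrow> \<Psi> x \<le> U x"
    and W: "continuous_on {0..L} W" "\<And>x. 0 < x \<Longrightarrow> x < L \<Longrightarrow> W x \<le> \<Psi> x"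
  shows "W L \<le> 0"
proof -
  have nonpos: "W y \<le> 0" if y: "0 < y" "y < L" for y
  proof -
    have "((\<lambda>x. U x) \<longlongrightarrow> 0) (at_right 0)"
      using U(1,2) \<open>L > 0\<close> by (metis continuous_on_Icc_at_rightD)
    moreover have "\<forall>\<^sub>F x in at_right 0. W y \<le> U x"
      unfolding eventually_at_right_field
    proof (intro exI[of _ y] conjI allI impI)
      fix x assume "0 < x" "x < y"
      then show "W y \<le> U x"
        using W(2)[of y] anti[of x y] U(3)[of x] y by linarith
    qed (use y in auto)
    ultimately show ?thesis
      by (rule tendsto_lowerbound) simp
  qed
  have "((\<lambda>x. W x) \<longlongrightarrow> W L) (at_left L)"
    using W(1) \<open>L > 0\<close> by (metis continuous_on_Icc_at_leftD)
  moreover have "\<forall>\<^sub>F x in at_left L. W x \<le> 0"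
    unfolding eventually_at_left_field
    using nonpos \<open>L > 0\<close> by (intro exI[of _ 0]) auto
  ultimately show ?thesis
    by (rule tendsto_upperbound) simp
qed

text \<open>The Pohozaev energy of \<open>(x\<^sup>\<kappa> u')' = - x\<^bsup>\<kappa>-1\<^esup> v\<^sup>\<delta> u\<^sup>s\<close> for a given coefficient \<open>v\<^sup>\<delta>\<close>. In this
  variable \<open>2\<kappa>\<close> plays the role of the dimension, and the critical exponent is given by
  \<open>\<kappa>/(s+1) = (\<kappa>-1)/2\<close>.\<close>
definition single_pohozaev ::
    "real \<Rightarrow> real \<Rightarrow> (real \<Rightarrow> real) \<Rightarrow> (real \<Rightarrow> real) \<Rightarrow> (real \<Rightarrow> real) \<Rightarrow> real \<Rightarrow> real" where
  "single_pohozaev \<kappa> s f u P x = x powr \<kappa> * (x * P x * P x) / 2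
     + x powr \<kappa> * (u x * f x) / (s + 1) - (\<kappa> - 1) / 2 * (x powr \<kappa> * (P x * u x))"

lemma single_pohozaev_derivative:
  fixes u v :: "real \<Rightarrow> real" and s \<delta> :: real
  defines "f \<equiv> power_source s \<delta> u v"
  assumes u: "radial_poisson \<kappa> f u P" and v: "(v has_real_derivative - Q) (at x)"
    and "x > 0" "u x > 0" "v x > 0" "s > 0"
  shows "(single_pohozaev \<kappa> s f u P has_real_derivative
    x powr \<kappa> * u x * f x * ((\<kappa> / (s + 1) - (\<kappa> - 1) / 2) / x - \<delta> * Q / (v x * (s + 1)))) (at x)"
proof -
  note u' = radial_poissonD(3)[OF u \<open>x > 0\<close>]
  have f': "(f has_real_derivative - f x * (s * P x / u x + \<delta> * Q / v x)) (at x)"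
    unfolding f_def by (rule power_source_derivative[OF u' v]) fact+
  have "(single_pohozaev \<kappa> s f u P has_real_derivative
     x powr \<kappa> * (f x * P x + P x * f x - (\<kappa> - 1) * P x * P x) / 2
     + x powr \<kappa> * (\<kappa> * u x * f x / x - f x * P x - u x * f x * (s * P x / u x + \<delta> * Q / v x)) / (s + 1)
     - (\<kappa> - 1) / 2 * (x powr \<kappa> * (f x * u x / x - P x * P x))) (at x)"
    unfolding single_pohozaev_def
    by (intro DERIV_diff DERIV_add DERIV_cdivide DERIV_cmult gradient_product_derivative[OF u u]
        source_product_derivative[OF u' f'] flux_product_derivative[OF u u']) fact+
  also have "x powr \<kappa> * (f x * P x + P x * f x - (\<kappa> - 1) * P x * P x) / 2
     + x powr \<kappa> * (\<kappa> * u x * f x / x - f x * P x - u x * f x * (s * P x / u x + \<delta> * Q / v x)) / (s + 1)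
     - (\<kappa> - 1) / 2 * (x powr \<kappa> * (f x * u x / x - P x * P x))
    = x powr \<kappa> * u x * f x * ((\<kappa> / (s + 1) - (\<kappa> - 1) / 2) / x - \<delta> * Q / (v x * (s + 1)))"
  proof -
    have "s + 1 \<noteq> 0" using \<open>s > 0\<close> by simp
    then show ?thesis
      using \<open>x > 0\<close> \<open>u x > 0\<close> \<open>v x > 0\<close> by (simp add: divide_simps) algebra
  qed
  finally show ?thesis .
qed

text \<open>For \<open>X, Y \<le> n\<close> the claim is \<open>(X - Y)\<^sup>2 (X + Y - n) \<le> n X Y\<close>, and it follows from
  \<open>n (X + Y - n) \<le> X Y\<close>, that is \<open>(n - X)(n - Y) \<ge> 0\<close>. Near a zero of \<open>u\<close> the slope \<open>X\<close> is
  unbounded and the quadratic expression becomes negative; hence the other branch, which alone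
  gives the right-hand side.\<close>
lemma slope_inequality:
  fixes X Y n :: real
  assumes "X \<ge> 0" "Y \<ge> 0" "n > 0"
  defines "H \<equiv> \<lambda>X Y. if X \<le> n then X\<^sup>2 * (n + Y - X) / 2 else n * X * Y / 2"
  shows "n * X * Y / 2 \<le> H X Y + H Y X"
proof -
  have nonneg: "H X Y \<ge> 0" if "X \<ge> 0" "Y \<ge> 0" for X Y
    using that \<open>n > 0\<close> unfolding H_def by auto
  consider "X > n" | "Y > n" | "X \<le> n" "Y \<le> n" by linarith
  then show ?thesis
  proof cases
    case 1
    then show ?thesis using nonneg[OF assms(2,1)] by (simp add: H_def)
  next
    case 2
    then show ?thesis using nonneg[OF assms(1,2)] by (simp add: H_def mult.commute mult.left_commute)
  next
    case 3
    have "(X - Y)\<^sup>2 * (X + Y - n) \<le> n * X * Y"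
    proof (cases "X + Y \<le> n")
      case True
      then have "(X - Y)\<^sup>2 * (X + Y - n) \<le> 0" by (simp add: mult_nonneg_nonpos)
      moreover have "n * X * Y \<ge> 0" using assms by simp
      ultimately show ?thesis by linarith
    next
      case False
      have "(n - X) * (n - Y) \<ge> 0" using 3 by simp
      then have *: "n * (X + Y - n) \<le> X * Y" by (simp add: algebra_simps)
      have "(X - Y)\<^sup>2 \<le> n\<^sup>2" using 3 assms by (intro power2_le_iff_abs_le[THEN iffD2]) auto
      then have "(X - Y)\<^sup>2 * (X + Y - n) \<le> n\<^sup>2 * (X + Y - n)"
        using False by (intro mult_right_mono) auto
      also have "\<dots> = n * (n * (X + Y - n))" by (simp add: power2_eq_square)
      also have "\<dots> \<le> n * (X * Y)" using * \<open>n > 0\<close> by (intro mult_left_mono) auto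
      finally show ?thesis by simp
    qed
    then have "n * X * Y \<le> X\<^sup>2 * (n + Y - X) + Y\<^sup>2 * (n + X - Y)"
      by (simp add: algebra_simps power2_eq_square)
    then show ?thesis using 3 by (simp add: H_def)
  qed
qed

locale positive_pair =
  fixes \<kappa> s \<delta> \<mu> L :: real and u v P Q :: "real \<Rightarrow> real"
  assumes \<kappa>: "\<kappa> > 1" and s: "s > 0" and \<delta>: "\<delta> > 0" and \<mu>: "\<mu> > 0" and L: "L > 0"
    and u: "radial_poisson \<kappa> (power_source s \<delta> u v) u P"
    and v: "radial_poisson \<kappa> (power_source s \<mu> v u) v Q"
    and u_pos: "\<And>x. 0 \<le> x \<Longrightarrow> x < L \<Longrightarrow> u x > 0"
    and v_pos: "\<And>x. 0 \<le> x \<Longrightarrow> x < L \<Longrightarrow> v x > 0"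
begin

lemma swap: "positive_pair \<kappa> s \<mu> \<delta> L v u Q P"
  by unfold_locales (use \<kappa> s \<delta> \<mu> L u v u_pos v_pos in auto)

abbreviation f where "f \<equiv> power_source s \<delta> u v"
abbreviation h where "h \<equiv> power_source s \<mu> v u"

lemma continuous:
  assumes "A \<subseteq> {0..}"
  shows "continuous_on A u" "continuous_on A v" "continuous_on A P" "continuous_on A Q"
    "continuous_on A f" "continuous_on A h" "continuous_on A (\<lambda>x. x powr \<kappa>)"
proof -
  show *: "continuous_on A u" "continuous_on A v" "continuous_on A P" "continuous_on A Q"
    using radial_poissonD(1,2)[OF u] radial_poissonD(1,2)[OF v] assms
    by (auto intro: continuous_on_subset)
  show "continuous_on A f" "continuous_on A h"
    by (rule continuous_power_source; use s \<delta> \<mu> * in simp)+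
  show "continuous_on A (\<lambda>x. x powr \<kappa>)"
    by (rule continuous_on_subset[OF continuous_on_powr_0 assms]) (use \<kappa> in auto)
qed

lemma P_pos: "0 < x \<Longrightarrow> x \<le> L \<Longrightarrow> P x > 0"
  by (rule radial_poisson_gradient_pos[OF u]) (use \<kappa> in \<open>auto intro!: power_source_pos u_pos v_pos\<close>)

lemma Q_pos: "0 < x \<Longrightarrow> x \<le> L \<Longrightarrow> Q x > 0"
  by (rule positive_pair.P_pos[OF swap])

lemma u'[derivative_intros]: "0 < x \<Longrightarrow> (u has_real_derivative - P x) (at x)"
  by (rule radial_poissonD[OF u])

lemma v'[derivative_intros]: "0 < x \<Longrightarrow> (v has_real_derivative - Q x) (at x)"
  by (rule radial_poissonD[OF v])

lemma f':
  assumes "0 < x" "x < L"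
  shows "(f has_real_derivative - f x * (s * P x / u x + \<delta> * Q x / v x)) (at x)"
  by (rule power_source_derivative) (use assms in \<open>auto intro!: u' v' u_pos v_pos\<close>)

lemma h':
  assumes "0 < x" "x < L"
  shows "(h has_real_derivative - h x * (s * Q x / v x + \<mu> * P x / u x)) (at x)"
  by (rule positive_pair.f'[OF swap]) fact+

text \<open>The energy of the first equation starts at \<open>0\<close> and decreases, because \<open>v\<close> does and the exponent
  is at least critical. At a zero of \<open>u\<close> it would be \<open>L\<^bsup>\<kappa>+1\<^esup> P(L)\<^sup>2 / 2 > 0\<close>.\<close>
lemma no_zero_supercritical:
  assumes crit: "\<kappa> / (s + 1) \<le> (\<kappa> - 1) / 2" and "u L = 0"
  shows False
proof -
  have "L powr \<kappa> * (L * P L * P L) / 2 - (\<kappa> - 1) / 2 * (L powr \<kappa> * (P L * u L)) \<le> 0"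
  proof (rule antimono_boundary_values[of L "single_pohozaev \<kappa> s f u P"
        "\<lambda>x. x powr \<kappa> * (x * P x * P x) / 2 + x powr \<kappa> * (u x * f x) / (s + 1)"])
    fix x y assume xy: "0 < x" "x \<le> y" "y < L"
    show "single_pohozaev \<kappa> s f u P y \<le> single_pohozaev \<kappa> s f u P x"
    proof (rule antimono_except_finite[of x y "{}"])
      show "continuous_on {x..y} (single_pohozaev \<kappa> s f u P)"
        unfolding single_pohozaev_def[abs_def]
        by (intro continuous_intros continuous) (use xy s in auto)
      fix z assume z: "x < z" "z < y"
      have "(single_pohozaev \<kappa> s f u P has_real_derivative
        z powr \<kappa> * u z * f z * ((\<kappa> / (s + 1) - (\<kappa> - 1) / 2) / z - \<delta> * Q z / (v z * (s + 1)))) (at z)"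
        by (rule single_pohozaev_derivative[OF u v']) (use z xy s in \<open>auto intro!: u_pos v_pos\<close>)
      moreover have "z powr \<kappa> * u z * f z
          * ((\<kappa> / (s + 1) - (\<kappa> - 1) / 2) / z - \<delta> * Q z / (v z * (s + 1))) \<le> 0"
      proof (rule mult_nonneg_nonpos)
        show "0 \<le> z powr \<kappa> * u z * f z" using u_pos[of z] z xy by simp
        have "(\<kappa> / (s + 1) - (\<kappa> - 1) / 2) / z \<le> 0" using crit z xy by (simp add: divide_nonpos_pos)
        moreover have "\<delta> * Q z / (v z * (s + 1)) \<ge> 0"
          using \<delta> s Q_pos[of z] v_pos[of z] z xy by auto
        ultimately show "(\<kappa> / (s + 1) - (\<kappa> - 1) / 2) / z - \<delta> * Q z / (v z * (s + 1)) \<le> 0" by linarith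
      qed
      ultimately show "\<exists>D. (single_pohozaev \<kappa> s f u P has_real_derivative D) (at z) \<and> D \<le> 0" by blast
    qed (use xy in auto)
  next
    fix x assume x: "0 < x" "x < L"
    have "0 \<le> (\<kappa> - 1) / 2 * (x powr \<kappa> * (P x * u x))"
      using \<kappa> P_pos[of x] u_pos[of x] x by simp
    then show "single_pohozaev \<kappa> s f u P x
        \<le> x powr \<kappa> * (x * P x * P x) / 2 + x powr \<kappa> * (u x * f x) / (s + 1)"
      unfolding single_pohozaev_def by linarith
    have "0 \<le> x powr \<kappa> * (u x * f x) / (s + 1)" using s u_pos[of x] x by simp
    then show "x powr \<kappa> * (x * P x * P x) / 2 - (\<kappa> - 1) / 2 * (x powr \<kappa> * (P x * u x))
        \<le> single_pohozaev \<kappa> s f u P x"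
      unfolding single_pohozaev_def by linarith
  qed (use L \<kappa> s in \<open>auto intro!: continuous_intros continuous\<close>)
  moreover have "L powr \<kappa> * (L * P L * P L) / 2 > 0" using L P_pos[of L] by simp
  ultimately show False using \<open>u L = 0\<close> by simp
qed

text \<open>This is \<open>u v x\<^bsup>\<kappa>-1\<^esup> \<phi>(X)\<close> with \<open>\<phi>(X) = X min(X, \<kappa>-1) / 2\<close>. The quadratic branch absorbs the
  term \<open>x\<^sup>\<kappa> v f P / u\<close> of the energy identity exactly; beyond the level \<open>\<kappa>-1\<close> a linear \<open>\<phi>\<close> keeps the
  remainder nonnegative when \<open>X\<close> is large and \<open>Y\<close> small.\<close>
definition slope_energy :: "real \<Rightarrow> real" where
  "slope_energy x = x powr \<kappa> * (P x * v x) * min (x * P x / u x) (\<kappa> - 1) / 2"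

lemma slope_energy_derivative:
  assumes x: "0 < x" "x < L" and neq: "x * P x / u x \<noteq> \<kappa> - 1"
  defines "X \<equiv> x * P x / u x" and "Y \<equiv> x * Q x / v x" and "n \<equiv> \<kappa> - 1"
  shows "\<exists>D. (slope_energy has_real_derivative D) (at x) \<and>
    D \<le> x powr \<kappa> * v x * f x * P x / u x - x powr \<kappa> * u x * v x / x\<^sup>2 *
      (if X \<le> n then X\<^sup>2 * (n + Y - X) / 2 else n * X * Y / 2)"
proof -
  have pos: "u x > 0" "v x > 0" "P x > 0" "Q x > 0" "x > 0" "n > 0"
    using x u_pos v_pos P_pos Q_pos \<kappa> by (auto simp: n_def)
  note flux = flux_product_derivative[OF u v', OF x(1) x(1)]
  have slope: "((\<lambda>x. x * P x / u x) has_real_derivative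
     (f x + P x * (X - n)) / u x) (at x)"
    using pos
    by (auto intro!: derivative_eq_intros u' radial_poissonD(4)[OF u]
        simp: X_def n_def field_simps)
  have tend: "((\<lambda>x. x * P x / u x) \<longlongrightarrow> X) (nhds x)"
    using DERIV_isCont[OF slope] unfolding isCont_def X_def
    by (rule tendsto_at_iff_tendsto_nhds[where g = "\<lambda>x. x * P x / u x", THEN iffD1])
  show ?thesis
  proof (cases "X < n")
    case True
    have "\<forall>\<^sub>F y in nhds x. y * P y / u y < n"
      using order_tendstoD(2)[OF tend True] .
    then have ev: "\<forall>\<^sub>F y in nhds x. slope_energy y = y powr \<kappa> * (P y * v y) * (y * P y / u y) / 2"
      by eventually_elim (simp add: slope_energy_def n_def)
    have "((\<lambda>y. y powr \<kappa> * (P y * v y) * (y * P y / u y) / 2) has_real_derivative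
      (x powr \<kappa> * (f x * v x / x - P x * Q x) * (x * P x / u x)
        + (f x + P x * (X - n)) / u x * (x powr \<kappa> * (P x * v x))) / 2) (at x)"
      by (intro DERIV_cdivide DERIV_mult flux slope)
    also have "(x powr \<kappa> * (f x * v x / x - P x * Q x) * (x * P x / u x)
        + (f x + P x * (X - n)) / u x * (x powr \<kappa> * (P x * v x))) / 2
      = x powr \<kappa> * v x * f x * P x / u x - x powr \<kappa> * u x * v x / x\<^sup>2 * (X\<^sup>2 * (n + Y - X) / 2)"
      using pos unfolding X_def Y_def by (simp add: divide_simps) algebra
    finally show ?thesis
      using DERIV_cong_ev[OF refl ev refl] True by auto
  next
    case False
    then have gt: "X > n" using neq by (simp add: X_def n_def)
    have "\<forall>\<^sub>F y in nhds x. y * P y / u y > n"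
      using order_tendstoD(1)[OF tend gt] .
    then have ev: "\<forall>\<^sub>F y in nhds x. slope_energy y = y powr \<kappa> * (P y * v y) * n / 2"
      by eventually_elim (simp add: slope_energy_def n_def)
    have "((\<lambda>y. y powr \<kappa> * (P y * v y) * n / 2) has_real_derivative
      (x powr \<kappa> * (f x * v x / x - P x * Q x)) * n / 2) (at x)"
      by (intro DERIV_cdivide DERIV_cmult_right flux)
    moreover have "(x powr \<kappa> * (f x * v x / x - P x * Q x)) * n / 2
      \<le> x powr \<kappa> * v x * f x * P x / u x - x powr \<kappa> * u x * v x / x\<^sup>2 * (n * X * Y / 2)"
    proof -
      have "x powr \<kappa> * (f x * v x / x) * n / 2 = x powr \<kappa> * v x * f x / x * (n / 2)" by simp
      also have "\<dots> \<le> x powr \<kappa> * v x * f x / x * X"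
        using gt pos by (intro mult_left_mono) auto
      also have "\<dots> = x powr \<kappa> * v x * f x * P x / u x" using pos by (simp add: X_def)
      finally have "x powr \<kappa> * (f x * v x / x) * n / 2 \<le> x powr \<kappa> * v x * f x * P x / u x" .
      moreover have "x powr \<kappa> * u x * v x / x\<^sup>2 * (n * X * Y / 2) = x powr \<kappa> * (P x * Q x) * n / 2"
        using pos by (simp add: X_def Y_def power2_eq_square)
      moreover have "(x powr \<kappa> * (f x * v x / x - P x * Q x)) * n / 2
          = x powr \<kappa> * (f x * v x / x) * n / 2 - x powr \<kappa> * (P x * Q x) * n / 2"
        by (simp add: right_diff_distrib left_diff_distrib diff_divide_distrib)
      ultimately show ?thesis by linarith
    qed
    ultimately show ?thesis
      using DERIV_cong_ev[OF refl ev refl] gt by auto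
  qed
qed

text \<open>Beyond its first crossing \<open>X\<close> stays above the level, by \<open>radial_slope_derivative\<close>; so the kink of
  \<open>\<phi>\<close> is met at most once.\<close>
lemma finite_slope_crossings: "finite {x \<in> {0<..<L}. x * P x / u x = \<kappa> - 1}"
proof -
  have "x = y" if "0 < x" "x < L" "x * P x / u x = \<kappa> - 1" "0 < y" "y < L" "y * P y / u y = \<kappa> - 1" for x y
  proof -
    have *: False if "0 < x" "x < y" "y < L" "x * P x / u x = \<kappa> - 1" "y * P y / u y = \<kappa> - 1" for x y
    proof -
      have "x * P x - (\<kappa> - 1) * u x < y * P y - (\<kappa> - 1) * u y"
      proof (rule DERIV_pos_imp_increasing[OF \<open>x < y\<close>])
        fix z assume z: "x \<le> z" "z \<le> y"
        then have "f z > 0" using that by (intro power_source_pos u_pos v_pos) auto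
        with z show "\<exists>D. ((\<lambda>x. x * P x - (\<kappa> - 1) * u x) has_real_derivative D) (at z) \<and> 0 < D"
          using that radial_slope_derivative[OF u, of z] by force
      qed
      then show False using that u_pos[of x] u_pos[of y] by (simp add: field_simps)
    qed
    show ?thesis using *[of x y] *[of y x] that by (cases x y rule: linorder_cases) auto
  qed
  then have "{x \<in> {0<..<L}. x * P x / u x = \<kappa> - 1} \<subseteq> {y}"
    if "y \<in> {x \<in> {0<..<L}. x * P x / u x = \<kappa> - 1}" for y
    using that by auto
  then show ?thesis
    by (cases "{x \<in> {0<..<L}. x * P x / u x = \<kappa> - 1} = {}")
       (auto intro: finite_subset)
qed

text \<open>The Pohozaev energy obtained from the multipliers \<open>x u'\<close>, \<open>x v'\<close>, \<open>\<kappa> v / (\<delta>+1)\<close> and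
  \<open>\<kappa> u / (\<mu>+1)\<close>. The weights are chosen such that only a multiple of \<open>x\<^sup>\<kappa> P Q\<close> remains in the derivative,
  apart from two terms with factor \<open>s\<close>. The latter appear because the system is not variational for
  \<open>s > 0\<close>; they have a favourable sign.\<close>

definition pair_energy :: "real \<Rightarrow> real" where
  "pair_energy x = x powr \<kappa> * (x * P x * Q x)
     + (1 / (\<mu> + 1) * (x powr \<kappa> * (u x * h x)) + 1 / (\<delta> + 1) * (x powr \<kappa> * (v x * f x)))
     - \<kappa> * (1 / (\<mu> + 1) * (x powr \<kappa> * (Q x * u x)) + 1 / (\<delta> + 1) * (x powr \<kappa> * (P x * v x)))"

lemma pair_energy_derivative:
  assumes x: "0 < x" "x < L"
  shows "(pair_energy has_real_derivative
     (\<kappa> / (\<mu> + 1) + \<kappa> / (\<delta> + 1) - (\<kappa> - 1)) * (x powr \<kappa> * P x * Q x)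
     - s / (\<mu> + 1) * (x powr \<kappa> * u x * h x * Q x / v x)
     - s / (\<delta> + 1) * (x powr \<kappa> * v x * f x * P x / u x)) (at x)"
proof -
  have pos: "u x > 0" "v x > 0" "x > 0" "\<mu> + 1 > 0" "\<delta> + 1 > 0"
    using x u_pos v_pos \<mu> \<delta> by auto
  note d = gradient_product_derivative[OF u v x(1)]
    source_product_derivative[OF u'[OF x(1)] h'[OF x] x(1)]
    source_product_derivative[OF v'[OF x(1)] f'[OF x] x(1)]
    flux_product_derivative[OF v u'[OF x(1)] x(1)]
    flux_product_derivative[OF u v'[OF x(1)] x(1)]
  have "(pair_energy has_real_derivative
     x powr \<kappa> * (f x * Q x + P x * h x - (\<kappa> - 1) * P x * Q x)
     + (1 / (\<mu> + 1) * (x powr \<kappa> * (\<kappa> * u x * h x / x - h x * P x - u x * h x * (s * Q x / v x + \<mu> * P x / u x)))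
      + 1 / (\<delta> + 1) * (x powr \<kappa> * (\<kappa> * v x * f x / x - f x * Q x - v x * f x * (s * P x / u x + \<delta> * Q x / v x))))
     - \<kappa> * (1 / (\<mu> + 1) * (x powr \<kappa> * (h x * u x / x - Q x * P x))
      + 1 / (\<delta> + 1) * (x powr \<kappa> * (f x * v x / x - P x * Q x)))) (at x)"
    unfolding pair_energy_def[abs_def]
    by (intro DERIV_diff DERIV_add DERIV_cmult d)
  also have "x powr \<kappa> * (f x * Q x + P x * h x - (\<kappa> - 1) * P x * Q x)
     + (1 / (\<mu> + 1) * (x powr \<kappa> * (\<kappa> * u x * h x / x - h x * P x - u x * h x * (s * Q x / v x + \<mu> * P x / u x)))
      + 1 / (\<delta> + 1) * (x powr \<kappa> * (\<kappa> * v x * f x / x - f x * Q x - v x * f x * (s * P x / u x + \<delta> * Q x / v x))))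
     - \<kappa> * (1 / (\<mu> + 1) * (x powr \<kappa> * (h x * u x / x - Q x * P x))
      + 1 / (\<delta> + 1) * (x powr \<kappa> * (f x * v x / x - P x * Q x)))
    = (\<kappa> / (\<mu> + 1) + \<kappa> / (\<delta> + 1) - (\<kappa> - 1)) * (x powr \<kappa> * P x * Q x)
     - s / (\<mu> + 1) * (x powr \<kappa> * u x * h x * Q x / v x)
     - s / (\<delta> + 1) * (x powr \<kappa> * v x * f x * P x / u x)"
  proof -
    have "u x * h x * (s * Q x / v x + \<mu> * P x / u x) = s * (u x * h x * Q x / v x) + \<mu> * (h x * P x)"
      "v x * f x * (s * P x / u x + \<delta> * Q x / v x) = s * (v x * f x * P x / u x) + \<delta> * (f x * Q x)"
      using pos by (simp_all add: distrib_left)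
    moreover have "\<mu> * (1 / (\<mu> + 1)) = 1 - 1 / (\<mu> + 1)" "\<delta> * (1 / (\<delta> + 1)) = 1 - 1 / (\<delta> + 1)"
      using pos by (auto simp: field_simps)
    moreover define A B Wu Wv m1 m2 where "A = f x / x" and "B = h x / x"
      and "Wu = v x * f x * P x / u x" and "Wv = u x * h x * Q x / v x"
      and "m1 = 1 / (\<mu> + 1)" and "m2 = 1 / (\<delta> + 1)"
    ultimately have e: "u x * h x * (s * Q x / v x + \<mu> * P x / u x) = s * Wv + \<mu> * (h x * P x)"
      "v x * f x * (s * P x / u x + \<delta> * Q x / v x) = s * Wu + \<delta> * (f x * Q x)"
      "\<mu> * m1 = 1 - m1" "\<delta> * m2 = 1 - m2" by simp_all
    have "x powr \<kappa> * (f x * Q x + P x * h x - (\<kappa> - 1) * P x * Q x)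
     + (m1 * (x powr \<kappa> * (\<kappa> * u x * B - h x * P x - (s * Wv + \<mu> * (h x * P x))))
      + m2 * (x powr \<kappa> * (\<kappa> * v x * A - f x * Q x - (s * Wu + \<delta> * (f x * Q x)))))
     - \<kappa> * (m1 * (x powr \<kappa> * (B * u x - Q x * P x))
      + m2 * (x powr \<kappa> * (A * v x - P x * Q x)))
    = (\<kappa> * m1 + \<kappa> * m2 - (\<kappa> - 1)) * (x powr \<kappa> * P x * Q x)
     - s * m1 * (x powr \<kappa> * Wv) - s * m2 * (x powr \<kappa> * Wu)"
      using e(3,4) by algebra
    then show ?thesis
      unfolding e(1,2) A_def B_def m1_def m2_def
      by (simp add: Wu_def Wv_def mult.assoc)
  qed
  finally show ?thesis .
qed

text \<open>Dropping the two terms with factor \<open>s\<close> would give a decreasing energy on and above the hyperbola only. The slope energies,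
  with the weight \<open>s m\<close>, convert them into at least \<open>s m n / 2\<close> times \<open>x\<^sup>\<kappa> P Q\<close>; this offsets the first
  term of the derivative when \<open>(\<delta>, \<mu>)\<close> is above the curve.\<close>

lemma no_simultaneous_zero:
  assumes crit: "\<kappa> / (\<mu> + 1) + \<kappa> / (\<delta> + 1)
      < (\<kappa> - 1) + (\<kappa> - 1) * s / 2 * min (1 / (\<mu> + 1)) (1 / (\<delta> + 1))"
    and zero: "u L = 0" "v L = 0"
  shows False
proof -
  interpret sw: positive_pair \<kappa> s \<mu> \<delta> L v u Q P by (rule swap)
  define m where "m = min (1 / (\<mu> + 1)) (1 / (\<delta> + 1))"
  define n where "n = \<kappa> - 1"
  define \<Psi> where "\<Psi> x = pair_energy x + s * m * (slope_energy x + sw.slope_energy x)" for x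
  have m: "m > 0" "m \<le> 1 / (\<mu> + 1)" "m \<le> 1 / (\<delta> + 1)" using \<mu> \<delta> by (auto simp: m_def)
  have n: "n > 0" using \<kappa> by (simp add: n_def)
  let ?S = "{x \<in> {0<..<L}. x * P x / u x = \<kappa> - 1} \<union> {x \<in> {0<..<L}. x * Q x / v x = \<kappa> - 1}"
  have anti: "\<Psi> y \<le> \<Psi> x" if xy: "0 < x" "x \<le> y" "y < L" for x y
  proof (rule antimono_except_finite[of x y ?S])
    have nz: "u z \<noteq> 0" "v z \<noteq> 0" if "z \<in> {x..y}" for z
      using u_pos[of z] v_pos[of z] that xy by auto
    show "continuous_on {x..y} \<Psi>"
      unfolding \<Psi>_def[abs_def] pair_energy_def[abs_def] slope_energy_def[abs_def] sw.slope_energy_def[abs_def]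
      by (intro continuous_intros continuous continuous_on_min) (use xy \<mu> \<delta> nz in auto)
    fix z assume z: "x < z" "z < y" "z \<notin> ?S"
    then have zL: "0 < z" "z < L" using xy by auto
    have pos: "u z > 0" "v z > 0" "P z > 0" "Q z > 0" "f z > 0" "h z > 0"
      using zL by (auto intro!: u_pos v_pos P_pos Q_pos power_source_pos)
    define X Y where "X = z * P z / u z" and "Y = z * Q z / v z"
    define H where "H X Y = (if X \<le> n then X\<^sup>2 * (n + Y - X) / 2 else n * X * Y / 2)" for X Y
    define g where "g = z powr \<kappa> * u z * v z / z\<^sup>2"
    define Su Sv where "Su = z powr \<kappa> * v z * f z * P z / u z" and "Sv = z powr \<kappa> * u z * h z * Q z / v z"
    have XY: "X \<ge> 0" "Y \<ge> 0" using pos zL by (auto simp: X_def Y_def)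
    have S: "Su \<ge> 0" "Sv \<ge> 0" using pos by (auto simp: Su_def Sv_def)
    have gXY: "g * (X * Y) = z powr \<kappa> * P z * Q z"
      using pos zL by (simp add: g_def X_def Y_def power2_eq_square)
    obtain D1 where D1: "(slope_energy has_real_derivative D1) (at z)" "D1 \<le> Su - g * H X Y"
      using slope_energy_derivative[OF zL] z zL
      unfolding Su_def g_def H_def X_def Y_def n_def by auto
    obtain D2 where D2: "(sw.slope_energy has_real_derivative D2) (at z)" "D2 \<le> Sv - g * H Y X"
      using sw.slope_energy_derivative[OF zL] z zL
      unfolding Sv_def g_def H_def X_def Y_def n_def by (auto simp: mult.commute mult.left_commute)
    have "(\<Psi> has_real_derivative
       (\<kappa> / (\<mu> + 1) + \<kappa> / (\<delta> + 1) - n) * (g * (X * Y)) - s / (\<mu> + 1) * Sv - s / (\<delta> + 1) * Su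
       + s * m * (D1 + D2)) (at z)"
      unfolding \<Psi>_def[abs_def] gXY Su_def Sv_def n_def
      by (intro DERIV_add DERIV_cmult pair_energy_derivative zL D1(1) D2(1))
    moreover have "(\<kappa> / (\<mu> + 1) + \<kappa> / (\<delta> + 1) - n) * (g * (X * Y)) - s / (\<mu> + 1) * Sv - s / (\<delta> + 1) * Su
       + s * m * (D1 + D2) \<le> 0"
    proof -
      have "D1 + D2 \<le> Su + Sv - g * (H X Y + H Y X)"
        using D1(2) D2(2) by (simp add: algebra_simps)
      also have "\<dots> \<le> Su + Sv - g * (n * X * Y / 2)"
      proof -
        have "g \<ge> 0" using pos by (simp add: g_def)
        moreover have "n * X * Y / 2 \<le> H X Y + H Y X"
          using slope_inequality[OF XY n] unfolding H_def by simp
        ultimately have "g * (n * X * Y / 2) \<le> g * (H X Y + H Y X)" by (rule mult_left_mono[rotated])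
        then show ?thesis by linarith
      qed
      finally have "s * m * (D1 + D2) \<le> s * m * (Su + Sv - g * (n * X * Y / 2))"
        using s m by (intro mult_left_mono) auto
      moreover have "s * m * Sv \<le> s * (1 / (\<mu> + 1)) * Sv" "s * m * Su \<le> s * (1 / (\<delta> + 1)) * Su"
        using s m S by (intro mult_right_mono mult_left_mono; simp)+
      moreover have "(\<kappa> / (\<mu> + 1) + \<kappa> / (\<delta> + 1) - n) * (g * (X * Y)) \<le> n * s / 2 * m * (g * (X * Y))"
      proof (rule mult_right_mono)
        show "\<kappa> / (\<mu> + 1) + \<kappa> / (\<delta> + 1) - n \<le> n * s / 2 * m"
          using crit unfolding m_def n_def by linarith
        show "0 \<le> g * (X * Y)" unfolding gXY using pos by simp
      qed
      moreover have "s * m * (Su + Sv - g * (n * X * Y / 2))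
          = s * m * Su + s * m * Sv - n * s / 2 * m * (g * (X * Y))"
        by (simp add: algebra_simps)
      moreover have "s * (1 / (\<mu> + 1)) * Sv = s / (\<mu> + 1) * Sv" "s * (1 / (\<delta> + 1)) * Su = s / (\<delta> + 1) * Su"
        by simp_all
      ultimately show ?thesis by linarith
    qed
    ultimately show "\<exists>D. (\<Psi> has_real_derivative D) (at z) \<and> D \<le> 0" by blast
  qed (use finite_slope_crossings sw.finite_slope_crossings xy in auto)
  \<comment> \<open>At a common zero only the first term of the energy survives in the lower bound.\<close>
  have "L powr \<kappa> * (L * P L * Q L)
      - \<kappa> * (1 / (\<mu> + 1) * (L powr \<kappa> * (Q L * u L)) + 1 / (\<delta> + 1) * (L powr \<kappa> * (P L * v L))) \<le> 0"
  proof (rule antimono_boundary_values[of L \<Psi> "\<lambda>x. x powr \<kappa> * (x * P x * Q x)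
     + (1 / (\<mu> + 1) * (x powr \<kappa> * (u x * h x)) + 1 / (\<delta> + 1) * (x powr \<kappa> * (v x * f x)))
     + s * m * (x powr \<kappa> * (P x * v x) * n / 2 + x powr \<kappa> * (Q x * u x) * n / 2)", OF L anti])
    fix x assume x: "0 < x" "x < L"
    have pos: "u x > 0" "v x > 0" "P x > 0" "Q x > 0" "f x > 0" "h x > 0"
      using x by (auto intro!: u_pos v_pos P_pos Q_pos power_source_pos)
    have sl: "slope_energy x \<le> x powr \<kappa> * (P x * v x) * n / 2" "sw.slope_energy x \<le> x powr \<kappa> * (Q x * u x) * n / 2"
      "0 \<le> slope_energy x" "0 \<le> sw.slope_energy x"
      unfolding slope_energy_def sw.slope_energy_def n_def
      using pos x \<kappa> by (auto intro!: divide_right_mono mult_left_mono)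
    have "\<kappa> * (1 / (\<mu> + 1) * (x powr \<kappa> * (Q x * u x)) + 1 / (\<delta> + 1) * (x powr \<kappa> * (P x * v x))) \<ge> 0"
      using pos \<kappa> \<mu> \<delta> by auto
    moreover have "s * m * (slope_energy x + sw.slope_energy x)
       \<le> s * m * (x powr \<kappa> * (P x * v x) * n / 2 + x powr \<kappa> * (Q x * u x) * n / 2)"
      using sl s m by (intro mult_left_mono add_mono) auto
    ultimately show "\<Psi> x \<le> x powr \<kappa> * (x * P x * Q x)
     + (1 / (\<mu> + 1) * (x powr \<kappa> * (u x * h x)) + 1 / (\<delta> + 1) * (x powr \<kappa> * (v x * f x)))
     + s * m * (x powr \<kappa> * (P x * v x) * n / 2 + x powr \<kappa> * (Q x * u x) * n / 2)"
      unfolding \<Psi>_def pair_energy_def by linarith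
    have "1 / (\<mu> + 1) * (x powr \<kappa> * (u x * h x)) + 1 / (\<delta> + 1) * (x powr \<kappa> * (v x * f x)) \<ge> 0"
      using pos \<mu> \<delta> by auto
    moreover have "s * m * (slope_energy x + sw.slope_energy x) \<ge> 0" using sl s m by simp
    ultimately show "x powr \<kappa> * (x * P x * Q x)
      - \<kappa> * (1 / (\<mu> + 1) * (x powr \<kappa> * (Q x * u x)) + 1 / (\<delta> + 1) * (x powr \<kappa> * (P x * v x))) \<le> \<Psi> x"
      unfolding \<Psi>_def pair_energy_def by linarith
  qed (use L \<kappa> \<mu> \<delta> in \<open>auto intro!: continuous_intros continuous\<close>)
  moreover have "L powr \<kappa> * (L * P L * Q L) > 0" using L P_pos[of L] Q_pos[of L] by simp
  ultimately show False using zero by simp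
qed

end

section \<open>The subcritical Lane--Emden equation\<close>

lemma positive_or_first_zero:
  fixes w :: "real \<Rightarrow> real"
  assumes "continuous_on {0..} w" "w 0 > 0"
  obtains "\<And>x. x \<ge> 0 \<Longrightarrow> w x > 0"
  | L where "L > 0" "w L = 0" "\<And>x. 0 \<le> x \<Longrightarrow> x < L \<Longrightarrow> w x > 0"
proof (cases "\<forall>x\<ge>0. w x > 0")
  case False
  then obtain b where b: "b \<ge> 0" "w b \<le> 0" by (auto simp: not_less)
  define Z where "Z = {x \<in> {0..b}. w x = 0}"
  have cont: "continuous_on {0..b} w" by (rule continuous_on_subset[OF assms(1)]) auto
  have zero_le: "\<exists>z\<in>Z. z \<le> y" if "0 \<le> y" "y \<le> b" "w y \<le> 0" for y
  proof -
    have "\<exists>z\<ge>0. z \<le> y \<and> w z = 0"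
      by (rule IVT2') (use that assms(2) in \<open>auto intro: continuous_on_subset[OF cont]\<close>)
    then show ?thesis using that by (auto simp: Z_def)
  qed
  have "compact Z"
  proof -
    have "closed Z" unfolding Z_def
      using continuous_closed_preimage_constant[OF cont, of 0] by simp
    moreover have "bounded Z"
      by (rule bounded_subset[of "{0..b}"]) (auto simp: Z_def)
    ultimately show ?thesis by (simp add: compact_eq_bounded_closed)
  qed
  moreover have "Z \<noteq> {}" using zero_le[of b] b by auto
  ultimately obtain L where L: "L \<in> Z" "\<And>z. z \<in> Z \<Longrightarrow> L \<le> z"
    using compact_attains_inf by metis
  show thesis
  proof (rule that(2))
    show "w L = 0" using L by (simp add: Z_def)
    then show "L > 0" using L assms(2) by (cases "L = 0") (auto simp: Z_def)
    fix x assume "0 \<le> x" "x < L"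
    then show "w x > 0"
      using zero_le[of x] L by (force simp: Z_def not_less[symmetric])
  qed
qed (use that in auto)

text \<open>If \<open>u\<close> stayed positive, then \<open>x P \<le> (\<kappa>-1) u\<close>, since otherwise \<open>u\<close> would decrease at least like a
  multiple of \<open>- ln x\<close>. With \<open>P \<ge> u\<^sup>s/\<kappa>\<close> this gives \<open>x u\<^sup>s \<le> \<kappa> (\<kappa>-1) u\<close>: impossible for \<open>s \<le> 1\<close>,
  and for \<open>s > 1\<close> a power decay that makes the Pohozaev energy tend to \<open>0\<close> at infinity. But in the
  subcritical range this energy increases from \<open>0\<close>.\<close>
lemma subcritical_zero:
  assumes "\<kappa> > 1" "s > 0" and crit: "\<kappa> / (s + 1) > (\<kappa> - 1) / 2"
    and u: "radial_poisson \<kappa> (power_source s \<delta> u (\<lambda>_. 1)) u P" and "u 0 = 1"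
  shows "\<exists>x>0. u x < 0"
proof (rule ccontr)
  assume "\<not> ?thesis"
  then have nn: "u x \<ge> 0" if "x > 0" for x using that by (meson not_less)
  define f where "f = power_source s \<delta> u (\<lambda>_. 1)"
  note u = u[folded f_def]
  have f_pos: "f x > 0" if "u x > 0" for x
    using that by (simp add: f_def power_source_pos)
  have f_nn: "f x \<ge> 0" for x by (simp add: f_def)
  define n where "n = \<kappa> - 1"
  have n: "n > 0" using assms(1) by (simp add: n_def)
  have pos: "u x > 0" if "x \<ge> 0" for x
  proof -
    have "u 0 > 0" using \<open>u 0 = 1\<close> by simp
    from radial_poissonD(1)[OF u] this show ?thesis
    proof (rule positive_or_first_zero)
      fix L assume L: "L > 0" "u L = 0" "\<And>x. 0 \<le> x \<Longrightarrow> x < L \<Longrightarrow> u x > 0"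
      have "P L > 0"
        by (rule radial_poisson_gradient_pos[OF u]) (use L assms(1) f_pos in auto)
      then obtain d where "d > 0" "\<forall>h>0. h < d \<longrightarrow> u (L + h) < u L"
        using DERIV_neg_dec_right[OF radial_poissonD(3)[OF u L(1)]] by auto
      then have "u (L + d / 2) < 0" using L by auto
      then show ?thesis using nn[of "L + d / 2"] L \<open>d > 0\<close> by simp
    qed (use that in auto)
  qed
  have f_eq: "f x = u x powr s" if "x \<ge> 0" for x
    using pos[OF that] by (simp add: f_def power_source_def)
  have anti: "u y \<le> u x" if "0 \<le> x" "x \<le> y" for x y
    by (rule radial_poisson_antimono[OF u]) (use that assms(1) f_nn in auto)
  have P_pos: "P x > 0" if "x > 0" for x
    by (rule radial_poisson_gradient_pos[OF u]) (use that assms(1) f_pos pos in auto)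
  have slope: "x * P x \<le> n * u x" if x: "x > 0" for x
  proof (rule ccontr)
    define c where "c = x * P x - n * u x"
    assume "\<not> ?thesis"
    then have c: "c > 0" by (simp add: c_def)
    have ge: "c \<le> y * P y" if "y \<ge> x" for y
    proof -
      have "x * P x - n * u x \<le> y * P y - n * u y"
        unfolding n_def
      proof (rule DERIV_nonneg_imp_nondecreasing[OF that])
        fix z assume "x \<le> z" "z \<le> y"
        then show "\<exists>D. ((\<lambda>x. x * P x - (\<kappa> - 1) * u x) has_real_derivative D) (at z) \<and> 0 \<le> D"
          using radial_slope_derivative[OF u, of z] x f_nn by auto
      qed
      moreover have "n * u y \<ge> 0" using n pos[of y] that x by simp
      ultimately show ?thesis unfolding c_def by linarith
    qed
    \<comment> \<open>The point at which the logarithmic bound has used up all of \<open>u x\<close>.\<close>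
    define y where "y = x * exp (u x / c)"
    have xy: "x \<le> y" using x c pos[of x] by (simp add: y_def)
    have "u y + c * ln y \<le> u x + c * ln x"
    proof (rule DERIV_nonpos_imp_nonincreasing[OF xy])
      fix z assume z: "x \<le> z" "z \<le> y"
      have "((\<lambda>z. u z + c * ln z) has_real_derivative (- P z + c * (1 / z))) (at z)"
        using z x by (auto intro!: derivative_eq_intros radial_poissonD(3)[OF u])
      moreover have "- P z + c * (1 / z) \<le> 0" using ge[of z] z x by (simp add: field_simps)
      ultimately show "\<exists>D. ((\<lambda>z. u z + c * ln z) has_real_derivative D) (at z) \<and> D \<le> 0" by blast
    qed
    moreover have "c * ln y = c * ln x + u x"
      using x c by (simp add: y_def ln_mult distrib_left)
    ultimately show False using pos[of y] xy x by simp
  qed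
  have decay: "x * u x powr s \<le> \<kappa> * n * u x" if x: "x > 0" for x
  proof -
    have "P x \<ge> u x powr s / \<kappa>"
    proof (rule radial_poisson_gradient_ge[OF u])
      fix y assume y: "0 < y" "y < x"
      show "u x powr s \<le> f y"
        using anti[of y x] pos[of x] y x \<open>s > 0\<close> by (simp add: f_eq powr_mono2)
    qed (use assms x in auto)
    then have "x * u x powr s \<le> \<kappa> * (x * P x)" using assms(1) x by (simp add: field_simps)
    also have "\<dots> \<le> \<kappa> * (n * u x)" using slope[OF x] assms(1) by (intro mult_left_mono) auto
    finally show ?thesis by simp
  qed
  define E where "E = single_pohozaev \<kappa> s f u P"
  have E': "(E has_real_derivative x powr \<kappa> * u x * f x * ((\<kappa> / (s + 1) - (\<kappa> - 1) / 2) / x)) (at x)"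
    if "x > 0" for x
    using single_pohozaev_derivative[OF u[unfolded f_def], of 0 x] that pos[of x] \<open>s > 0\<close>
    unfolding E_def f_def by simp
  have E_mono: "E x < E y" if "0 < x" "x < y" for x y
  proof (rule DERIV_pos_imp_increasing[OF that(2)])
    fix z assume "x \<le> z" "z \<le> y"
    then have z: "z > 0" "z \<ge> 0" using that by auto
    have "0 < z powr \<kappa> * u z * f z * ((\<kappa> / (s + 1) - (\<kappa> - 1) / 2) / z)"
      using z pos[OF z(2)] f_pos[of z] crit by (intro mult_pos_pos divide_pos_pos) auto
    with E'[OF z(1)] show "\<exists>D. (E has_real_derivative D) (at z) \<and> 0 < D" by blast
  qed
  have cont: "continuous_on A u" "continuous_on A P" "continuous_on A f" "continuous_on A (\<lambda>x. x powr \<kappa>)"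
    if "A \<subseteq> {0..}" for A
  proof -
    show "continuous_on A u" "continuous_on A P"
      using radial_poissonD(1,2)[OF u] that by (auto intro: continuous_on_subset)
    show "continuous_on A (\<lambda>x. x powr \<kappa>)"
      by (rule continuous_on_subset[OF continuous_on_powr_0 that]) (use assms in auto)
    have "continuous_on A (\<lambda>x. u x powr s)"
      by (intro continuous_on_powr' \<open>continuous_on A u\<close> continuous_on_const) (use pos that \<open>s > 0\<close> in force)
    then show "continuous_on A f"
      by (rule continuous_on_cong[THEN iffD1, rotated 2]) (use f_eq that in auto)
  qed
  \<comment> \<open>Only the sign is asked for here; strictness comes from a further step, to the point \<open>1\<close>.\<close>
  have "E (1/2) \<ge> 0"
  proof -
    have "- E (1/2) \<le> 0"
    proof (rule antimono_boundary_values[of "1/2" "\<lambda>x. - E x" "\<lambda>x. n / 2 * (x powr \<kappa> * (P x * u x))"])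
      show "continuous_on {0..1/2} (\<lambda>x. - E x)"
        unfolding E_def single_pohozaev_def
        by (intro continuous_intros cont) (use \<open>s > 0\<close> in auto)
      show "continuous_on {0..1/2} (\<lambda>x. n / 2 * (x powr \<kappa> * (P x * u x)))"
        by (intro continuous_intros cont) auto
      fix x :: real assume x: "0 < x" "x < 1/2"
      have "x powr \<kappa> * (x * P x * P x) / 2 + x powr \<kappa> * (u x * f x) / (s + 1) \<ge> 0"
        using x pos[of x] P_pos[of x] f_nn[of x] \<open>s > 0\<close> by simp
      then show "- E x \<le> n / 2 * (x powr \<kappa> * (P x * u x))"
        unfolding E_def single_pohozaev_def n_def by linarith
    next
      fix x y :: real assume "0 < x" "x \<le> y" "y < 1/2"
      then show "- E y \<le> - E x" using E_mono[of x y] by (cases "x = y") auto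
    qed simp_all
    then show ?thesis by simp
  qed
  then have E1: "E 1 > 0" using E_mono[of "1/2" 1] by simp
  define C where "C = n\<^sup>2 / 2 + \<kappa> * n / (s + 1)"
  have C: "C > 0" using n assms by (auto simp: C_def intro!: add_pos_pos)
  have E_le: "E x \<le> C * (x powr n * (u x)\<^sup>2)" if x: "x > 0" for x
  proof -
    have e: "x powr \<kappa> = x * x powr n" using x by (simp add: n_def powr_diff)
    have "(x * P x)\<^sup>2 \<le> (n * u x)\<^sup>2"
      using slope[OF x] P_pos[OF x] x by (intro power_mono) auto
    then have "x powr n * ((x * P x)\<^sup>2 / 2) \<le> x powr n * ((n * u x)\<^sup>2 / 2)" by (intro mult_left_mono) auto
    then have 1: "x powr \<kappa> * (x * P x * P x) / 2 \<le> n\<^sup>2 / 2 * (x powr n * (u x)\<^sup>2)"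
      unfolding e by (simp add: power2_eq_square algebra_simps)
    have "x powr n * u x * (x * u x powr s) \<le> x powr n * u x * (\<kappa> * n * u x)"
      using decay[OF x] pos[of x] x by (intro mult_left_mono) auto
    then have "x powr \<kappa> * (u x * f x) \<le> \<kappa> * n * (x powr n * (u x)\<^sup>2)"
      unfolding e using x by (simp add: f_eq power2_eq_square algebra_simps)
    then have "x powr \<kappa> * (u x * f x) / (s + 1) \<le> \<kappa> * n * (x powr n * (u x)\<^sup>2) / (s + 1)"
      using \<open>s > 0\<close> by (intro divide_right_mono) auto
    moreover have "0 \<le> (\<kappa> - 1) / 2 * (x powr \<kappa> * (P x * u x))"
      using assms(1) P_pos[OF x] pos[of x] x by simp
    ultimately have "E x \<le> n\<^sup>2 / 2 * (x powr n * (u x)\<^sup>2) + \<kappa> * n * (x powr n * (u x)\<^sup>2) / (s + 1)"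
      unfolding E_def single_pohozaev_def using 1 by linarith
    also have "\<dots> = C * (x powr n * (u x)\<^sup>2)" by (simp add: C_def distrib_right)
    finally show ?thesis .
  qed
  show False
  proof (cases "s \<le> 1")
    case True
    define x where "x = \<kappa> * n + 1"
    have x: "x > 0" using assms n by (simp add: x_def add_pos_pos)
    have "u x powr 1 \<le> u x powr s"
      using anti[of 0 x] pos[of x] x True \<open>u 0 = 1\<close> by (intro powr_mono') auto
    then have "x * u x \<le> x * u x powr s" using pos[of x] x by (intro mult_left_mono) auto
    also have "\<dots> \<le> \<kappa> * n * u x" by (rule decay[OF x])
    finally have "x \<le> \<kappa> * n" using pos[of x] x by simp
    then show False by (simp add: x_def)
  next
    case False
    define p where "p = 2 / (s - 1)"
    \<comment> \<open>Subcriticality says that \<open>u\<^sup>2 = O(x\<^bsup>-p\<^esup>)\<close> beats the factor \<open>x\<^sup>n\<close> in the bound for the energy.\<close>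
    have "(\<kappa> - 1) * (s - 1) < 2"
      using crit \<open>s > 0\<close> by (simp add: divide_simps) (simp add: algebra_simps)
    then have "n < p"
      using False by (simp add: p_def n_def pos_less_divide_eq)
    have p: "p > 0" using False by (simp add: p_def)
    have p2: "(s - 1) * p = 2"
      unfolding p_def times_divide_eq_right
      by (rule nonzero_mult_div_cancel_left) (use False in simp)
    have u2: "(u x)\<^sup>2 \<le> (\<kappa> * n) powr p * x powr (- p)" if x: "x > 0" for x
    proof -
      have ux: "u x > 0" using pos x by simp
      have "u x powr (s - 1) = u x powr s / u x" using ux by (simp add: powr_diff)
      also have "\<dots> \<le> \<kappa> * n / x" using decay[OF x] x ux by (simp add: field_simps)
      finally have "(u x powr (s - 1)) powr p \<le> (\<kappa> * n / x) powr p"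
        using p by (intro powr_mono2) auto
      moreover have "(u x powr (s - 1)) powr p = (u x)\<^sup>2"
        using ux by (simp add: powr_powr p2)
      moreover have "(\<kappa> * n / x) powr p = (\<kappa> * n) powr p * x powr (- p)"
        using x assms n by (simp add: powr_divide powr_minus_divide)
      ultimately show ?thesis by simp
    qed
    have "((\<lambda>x. C * (\<kappa> * n) powr p * x powr (n - p)) \<longlongrightarrow> C * (\<kappa> * n) powr p * 0) at_top"
      by (intro tendsto_mult tendsto_const tendsto_neg_powr filterlim_ident) (use \<open>n < p\<close> in auto)
    then have "\<forall>\<^sub>F x in at_top. C * (\<kappa> * n) powr p * x powr (n - p) < E 1"
      by (rule order_tendstoD) (use E1 in auto)
    then have "\<forall>\<^sub>F x in at_top. C * (\<kappa> * n) powr p * x powr (n - p) < E 1 \<and> x > 1"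
      using eventually_gt_at_top by (rule eventually_conj)
    then obtain x where x: "C * (\<kappa> * n) powr p * x powr (n - p) < E 1" "x > 1"
      by (auto dest!: eventually_happens)
    have "E x \<le> C * (x powr n * (u x)\<^sup>2)" using E_le x by simp
    also have "\<dots> \<le> C * (x powr n * ((\<kappa> * n) powr p * x powr (- p)))"
      using u2[of x] x C by (intro mult_left_mono) auto
    also have "\<dots> = C * (\<kappa> * n) powr p * x powr (n - p)"
      by (simp add: powr_diff powr_minus_divide)
    also have "\<dots> < E 1" by fact
    finally show False using E_mono[of 1 x] x by simp
  qed
qed

text \<open>At its first zero \<open>u\<close> has a negative derivative. So vanishing strictly first is visible as the open
  condition \<open>u(x) < 0 < v(x)\<close> at some point, which is stable under pointwise convergence.\<close>
lemma (in positive_pair) crosses_below_zero: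
  assumes "u L = 0" "v L > 0"
  shows "\<exists>x>0. u x < 0 \<and> v x > 0"
proof -
  obtain d where d: "d > 0" "\<forall>h>0. h < d \<longrightarrow> u (L + h) < u L"
    using DERIV_neg_dec_right[OF u'[OF L]] P_pos[of L] L by auto
  have "isCont v L" using v'[OF L] by (rule DERIV_isCont)
  then have "\<forall>\<^sub>F y in at L. v y > 0"
    using assms(2) by (intro order_tendstoD(1)) (auto simp: isCont_def)
  then obtain e where e: "e > 0" "\<And>y. y \<noteq> L \<Longrightarrow> dist y L < e \<Longrightarrow> v y > 0"
    by (auto simp: eventually_at)
  define h where "h = min (d / 2) (e / 2)"
  have "h > 0" "h < d" "h < e" using d e by (auto simp: h_def)
  then show ?thesis
    using d(2) e(2)[of "L + h"] assms L by (intro exI[of _ "L + h"]) (auto simp: dist_real_def)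
qed

section \<open>Shooting on the coefficients\<close>

lemma radial_poisson_cong:
  assumes "radial_poisson \<kappa> f u P" "\<And>x. x > 0 \<Longrightarrow> f x = g x"
  shows "radial_poisson \<kappa> g u P"
  using assms by (simp add: radial_poisson_def)

lemma radial_poisson_scale:
  assumes "radial_poisson \<kappa> f u P"
  shows "radial_poisson \<kappa> (\<lambda>x. c * f x) (\<lambda>x. c * u x) (\<lambda>x. c * P x)"
  unfolding radial_poisson_def
  using radial_poissonD[OF assms]
  by (auto intro!: continuous_intros derivative_eq_intros simp: field_simps)

text \<open>The initial values are normalised; the shooting parameters are the coefficients \<open>c\<close> and \<open>d\<close>.\<close>
definition weighted_pair where
  "weighted_pair \<kappa> s \<delta> \<mu> c d u v P Q \<longleftrightarrow>
     radial_poisson \<kappa> (\<lambda>x. c * power_source s \<delta> u v x) u P \<and>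
     radial_poisson \<kappa> (\<lambda>x. d * power_source s \<mu> v u x) v Q \<and> u 0 = 1 \<and> v 0 = 1"

lemma weighted_pair_swap:
  "weighted_pair \<kappa> s \<delta> \<mu> c d u v P Q \<Longrightarrow> weighted_pair \<kappa> s \<mu> \<delta> d c v u Q P"
  by (auto simp: weighted_pair_def)

text \<open>Without a source \<open>v\<close> is constant, which leaves a single Lane--Emden equation.\<close>
lemma weighted_pair_degenerate:
  assumes "weighted_pair \<kappa> s \<delta> \<mu> 1 0 u v P Q" "\<kappa> > 1" "s > 0" "\<kappa> / (s + 1) > (\<kappa> - 1) / 2"
  shows "\<exists>x>0. u x < 0 \<and> v x > 0"
proof -
  have v1: "v x = 1" if "x \<ge> 0" for x
    using radial_poisson_eq_const[of \<kappa> v Q x] assms that by (simp add: weighted_pair_def)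
  have "radial_poisson \<kappa> (power_source s \<delta> u (\<lambda>_. 1)) u P"
    using assms(1) v1 unfolding weighted_pair_def
    by (auto elim!: radial_poisson_cong simp: power_source_def)
  from subcritical_zero[OF assms(2,3,4) this] assms(1) obtain x where "x > 0" "u x < 0"
    by (auto simp: weighted_pair_def)
  then show ?thesis using v1[of x] by auto
qed

definition unit_clamp :: "real \<Rightarrow> real" where
  "unit_clamp z = max 0 (min 1 z)"

lemma unit_clamp_bounds [simp]: "0 \<le> unit_clamp z" "unit_clamp z \<le> 1"
  by (auto simp: unit_clamp_def)

text \<open>Clamping the unknowns to \<open>[0, 1]\<close> makes the sources bounded. The upper bound does not
  change solutions that start at \<open>1\<close>, because these are nonincreasing.\<close>
definition clamped_field :: "real \<Rightarrow> real \<Rightarrow> real \<Rightarrow> real \<Rightarrow> real \<times> real \<Rightarrow> real \<times> real" where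
  "clamped_field s \<delta> \<mu> \<tau> p =
     ((1 - unit_clamp \<tau>) * (unit_clamp (fst p) powr s * unit_clamp (snd p) powr \<delta>),
      unit_clamp \<tau> * (unit_clamp (snd p) powr s * unit_clamp (fst p) powr \<mu>))"

lemma continuous_on_unit_clamp_powr:
  assumes "continuous_on A f" "e > 0"
  shows "continuous_on A (\<lambda>x. unit_clamp (f x) powr e)"
  unfolding unit_clamp_def
  by (intro continuous_on_powr' continuous_on_max continuous_on_min continuous_on_const)
     (use assms in auto)

lemma bounded_clamped_ode:
  assumes "\<kappa> > 1" "s > 0" "\<delta> > 0" "\<mu> > 0"
  shows "bounded_radial_ode \<kappa> 2 (clamped_field s \<delta> \<mu>)"
proof
  show "\<kappa> > 1" by fact
  have c: "continuous_on UNIV (\<lambda>x::real \<times> real \<times> real. unit_clamp (fst x))"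
    unfolding unit_clamp_def by (intro continuous_intros)
  show "continuous_on UNIV (\<lambda>(\<tau>, p). clamped_field s \<delta> \<mu> \<tau> p)"
    unfolding clamped_field_def case_prod_beta
    by (intro continuous_intros c continuous_on_unit_clamp_powr) (use assms in auto)
  fix \<tau> :: real and p :: "real \<times> real"
  have b: "0 \<le> x * (unit_clamp y powr s * unit_clamp z powr e)
      \<and> x * (unit_clamp y powr s * unit_clamp z powr e) \<le> 1"
    if "0 \<le> x" "x \<le> 1" "e > 0" for x y z e
    using that assms by (auto intro!: mult_le_one powr_le1)
  have "\<bar>fst (clamped_field s \<delta> \<mu> \<tau> p)\<bar> \<le> 1" "\<bar>snd (clamped_field s \<delta> \<mu> \<tau> p)\<bar> \<le> 1"
    using b[of "1 - unit_clamp \<tau>" \<delta> "fst p" "snd p"] b[of "unit_clamp \<tau>" \<mu> "snd p" "fst p"] assms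
    unfolding clamped_field_def by auto
  then show "norm (clamped_field s \<delta> \<mu> \<tau> p) \<le> 2"
    using norm_Pair_le[of "fst (clamped_field s \<delta> \<mu> \<tau> p)" "snd (clamped_field s \<delta> \<mu> \<tau> p)"] by simp
qed

lemma clamped_solution_weighted_pair:
  assumes "\<kappa> > 1" "s > 0" "\<delta> > 0" "\<mu> > 0" and t: "t \<in> {0..1}" and p: "continuous_on UNIV p"
    and eq: "\<And>x. x \<ge> 0 \<Longrightarrow> p x = (1, 1) - radial_potential \<kappa> (\<lambda>z. clamped_field s \<delta> \<mu> t (p z)) x"
  obtains P Q where "weighted_pair \<kappa> s \<delta> \<mu> (1 - t) t (\<lambda>x. fst (p x)) (\<lambda>x. snd (p x)) P Q"
proof -
  interpret bounded_radial_ode \<kappa> 2 "clamped_field s \<delta> \<mu>" "(1, 1)"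
    by (rule bounded_clamped_ode) fact+
  define f where "f z = clamped_field s \<delta> \<mu> t (p z)" for z
  have f: "continuous_on UNIV f"
    unfolding f_def by (intro continuous_F_compose continuous_intros p)
  have eq': "p x = (1, 1) - radial_potential \<kappa> f x" if "x \<ge> 0" for x
    using eq[OF that] by (simp add: f_def[abs_def])
  note component = radial_poisson_component[OF assms(1) f p eq']
  have 1: "radial_poisson \<kappa> (\<lambda>x. fst (f x)) (\<lambda>x. fst (p x)) (\<lambda>x. fst (radial_mean \<kappa> f x))"
    by (rule component[OF _ bounded_linear_fst])
  have 2: "radial_poisson \<kappa> (\<lambda>x. snd (f x)) (\<lambda>x. snd (p x)) (\<lambda>x. snd (radial_mean \<kappa> f x))"
    by (rule component[OF _ bounded_linear_snd])
  have f_nn: "fst (f x) \<ge> 0" "snd (f x) \<ge> 0" for x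
    by (simp_all add: f_def clamped_field_def)
  have p0: "p 0 = (1, 1)" using eq'[of 0] by (simp add: radial_potential_def)
  have le: "fst (p x) \<le> 1" "snd (p x) \<le> 1" if "x \<ge> 0" for x
    using radial_poisson_antimono[OF 1, of 0 x] radial_poisson_antimono[OF 2, of 0 x] that assms(1) p0 f_nn
    by simp_all
  have t': "unit_clamp t = t" using t by (auto simp: unit_clamp_def)
  have c: "unit_clamp (fst (p x)) = max 0 (fst (p x))" "unit_clamp (snd (p x)) = max 0 (snd (p x))"
    if "x > 0" for x
    using le[of x] that by (auto simp: unit_clamp_def)
  show thesis
  proof (rule that)
    show "weighted_pair \<kappa> s \<delta> \<mu> (1 - t) t (\<lambda>x. fst (p x)) (\<lambda>x. snd (p x))
        (\<lambda>x. fst (radial_mean \<kappa> f x)) (\<lambda>x. snd (radial_mean \<kappa> f x))"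
      unfolding weighted_pair_def
    proof (intro conjI)
      show "radial_poisson \<kappa> (\<lambda>x. (1 - t) * power_source s \<delta> (\<lambda>x. fst (p x)) (\<lambda>x. snd (p x)) x)
          (\<lambda>x. fst (p x)) (\<lambda>x. fst (radial_mean \<kappa> f x))"
        by (rule radial_poisson_cong[OF 1]) (simp add: f_def clamped_field_def c t' power_source_def)
      show "radial_poisson \<kappa> (\<lambda>x. t * power_source s \<mu> (\<lambda>x. snd (p x)) (\<lambda>x. fst (p x)) x)
          (\<lambda>x. snd (p x)) (\<lambda>x. snd (radial_mean \<kappa> f x))"
        by (rule radial_poisson_cong[OF 2]) (simp add: f_def clamped_field_def c t' power_source_def)
    qed (use p0 in auto)
  qed
qed

context
  fixes \<kappa> s \<delta> \<mu> :: real
  assumes exponents: "\<kappa> > 1" "s > 0" "\<delta> > 0" "\<mu> > 0"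
begin

interpretation bounded_radial_ode \<kappa> 2 "clamped_field s \<delta> \<mu>" "(1, 1)"
  by (rule bounded_clamped_ode) (fact exponents)+

lemma weighted_pair_limit:
  fixes \<rho> :: "nat \<Rightarrow> nat" and \<tau> :: "nat \<Rightarrow> real"
  assumes "strict_mono \<rho>" "\<And>k. \<tau> k \<in> {0..1}"
  obtains r t u v P Q where "strict_mono (r :: nat \<Rightarrow> nat)" "t \<in> {0..1}" "(\<lambda>k. \<tau> (r k)) \<longlonglongrightarrow> t"
    "weighted_pair \<kappa> s \<delta> \<mu> (1 - t) t u v P Q"
    "\<forall>x\<ge>0. (\<lambda>k. fst (approx (\<rho> (r k)) (\<tau> (r k)) x)) \<longlonglongrightarrow> u x"
    "\<forall>x\<ge>0. (\<lambda>k. snd (approx (\<rho> (r k)) (\<tau> (r k)) x)) \<longlonglongrightarrow> v x"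
proof -
  obtain r t p where r: "strict_mono (r :: nat \<Rightarrow> nat)" "t \<in> {0..1}" "(\<lambda>k. \<tau> (r k)) \<longlonglongrightarrow> t"
    "continuous_on UNIV p"
    "\<forall>x\<ge>0. p x = (1, 1) - radial_potential \<kappa> (\<lambda>z. clamped_field s \<delta> \<mu> t (p z)) x"
    "\<forall>x\<ge>0. (\<lambda>k. approx (\<rho> (r k)) (\<tau> (r k)) x) \<longlonglongrightarrow> p x"
    by (rule approx_limit[where \<rho> = \<rho> and \<tau> = \<tau>, OF assms]) (rule that)
  obtain P Q where "weighted_pair \<kappa> s \<delta> \<mu> (1 - t) t (\<lambda>x. fst (p x)) (\<lambda>x. snd (p x)) P Q"
    by (rule clamped_solution_weighted_pair[OF exponents r(2,4) r(5)[rule_format]])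
  then show thesis
    by (rule that[OF r(1-3)]) (use r(6) in \<open>auto intro: tendsto_fst tendsto_snd\<close>)
qed

lemma weighted_pair_exists: "\<exists>u v P Q. weighted_pair \<kappa> s \<delta> \<mu> (1 / 2) (1 / 2) u v P Q"
proof -
  have id: "strict_mono (\<lambda>k::nat. k)" and half: "1 / 2 \<in> {0..1::real}" for k :: nat
    by (auto simp: strict_mono_def)
  obtain r t u v P Q where r: "strict_mono (r :: nat \<Rightarrow> nat)" "t \<in> {0..1}"
    "(\<lambda>k. 1 / 2) \<longlonglongrightarrow> (t::real)" "weighted_pair \<kappa> s \<delta> \<mu> (1 - t) t u v P Q"
    by (rule weighted_pair_limit[where \<rho> = "\<lambda>k. k" and \<tau> = "\<lambda>_. 1 / 2", OF id half]) (rule that)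
  have "t = 1 / 2" using r(3) by (simp only: LIMSEQ_const_iff)
  with r(4) have "weighted_pair \<kappa> s \<delta> \<mu> (1 / 2) (1 / 2) u v P Q" by simp
  then show ?thesis by blast
qed

text \<open>As both components are nonincreasing in \<open>x\<close>, opposite strict signs at one point decide which of them
  vanishes first.\<close>

definition fst_vanishes_first where
  "fst_vanishes_first k = {\<tau>. \<exists>x\<ge>0. fst (approx k \<tau> x) < 0 \<and> snd (approx k \<tau> x) > 0}"

definition snd_vanishes_first where
  "snd_vanishes_first k = {\<tau>. \<exists>x\<ge>0. snd (approx k \<tau> x) < 0 \<and> fst (approx k \<tau> x) > 0}"

lemma open_vanishes_first: "open (fst_vanishes_first k)" "open (snd_vanishes_first k)"
proof -
  have *: "continuous_on UNIV (\<lambda>\<tau>. fst (approx k \<tau> x))" "continuous_on UNIV (\<lambda>\<tau>. snd (approx k \<tau> x))" for x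
    by (intro continuous_intros approx_continuous)+
  have 1: "fst_vanishes_first k = (\<Union>x\<in>{0..}. {\<tau>. fst (approx k \<tau> x) < 0} \<inter> {\<tau>. 0 < snd (approx k \<tau> x)})"
    and 2: "snd_vanishes_first k = (\<Union>x\<in>{0..}. {\<tau>. snd (approx k \<tau> x) < 0} \<inter> {\<tau>. 0 < fst (approx k \<tau> x)})"
    by (auto simp: fst_vanishes_first_def snd_vanishes_first_def)
  show "open (fst_vanishes_first k)" "open (snd_vanishes_first k)"
    unfolding 1 2 by (intro open_UN ballI open_Int open_Collect_less continuous_on_const *)+
qed

lemma disjoint_vanishes_first: "fst_vanishes_first k \<inter> snd_vanishes_first k = {}"
proof -
  have F: "clamped_field s \<delta> \<mu> \<tau> p \<bullet> (1, 0) \<ge> 0" "clamped_field s \<delta> \<mu> \<tau> p \<bullet> (0, 1) \<ge> 0" for \<tau> p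
    by (auto simp: clamped_field_def inner_prod_def)
  have anti: "fst (approx k \<tau> y) \<le> fst (approx k \<tau> x)" "snd (approx k \<tau> y) \<le> snd (approx k \<tau> x)"
    if "0 \<le> x" "x \<le> y" for \<tau> x y
    using approx_antimono[OF F(1) that, of k \<tau>] approx_antimono[OF F(2) that, of k \<tau>]
    by (simp_all add: inner_prod_def)
  have False if x: "x \<ge> 0" "fst (approx k \<tau> x) < 0" "snd (approx k \<tau> x) > 0"
    and y: "y \<ge> 0" "snd (approx k \<tau> y) < 0" "fst (approx k \<tau> y) > 0" for \<tau> x y
    using anti[of x y \<tau>] anti[of y x \<tau>] that by linarith
  then show ?thesis by (fastforce simp: fst_vanishes_first_def snd_vanishes_first_def)
qed

lemma eventually_vanishes_first:
  assumes "(\<lambda>k. fst (approx (n k) (\<tau> k) x)) \<longlonglongrightarrow> a" "(\<lambda>k. snd (approx (n k) (\<tau> k) x)) \<longlonglongrightarrow> b" "x \<ge> 0"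
  shows "a < 0 \<Longrightarrow> b > 0 \<Longrightarrow> \<forall>\<^sub>F k in sequentially. \<tau> k \<in> fst_vanishes_first (n k)"
    and "b < 0 \<Longrightarrow> a > 0 \<Longrightarrow> \<forall>\<^sub>F k in sequentially. \<tau> k \<in> snd_vanishes_first (n k)"
proof -
  assume "a < 0" "b > 0"
  with assms(1,2) have "\<forall>\<^sub>F k in sequentially. fst (approx (n k) (\<tau> k) x) < 0"
    "\<forall>\<^sub>F k in sequentially. 0 < snd (approx (n k) (\<tau> k) x)"
    by (auto intro: order_tendstoD)
  then show "\<forall>\<^sub>F k in sequentially. \<tau> k \<in> fst_vanishes_first (n k)"
    by eventually_elim (use assms(3) in \<open>auto simp: fst_vanishes_first_def\<close>)
next
  assume "b < 0" "a > 0"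
  with assms(1,2) have "\<forall>\<^sub>F k in sequentially. snd (approx (n k) (\<tau> k) x) < 0"
    "\<forall>\<^sub>F k in sequentially. 0 < fst (approx (n k) (\<tau> k) x)"
    by (auto intro: order_tendstoD)
  then show "\<forall>\<^sub>F k in sequentially. \<tau> k \<in> snd_vanishes_first (n k)"
    by eventually_elim (use assms(3) in \<open>auto simp: snd_vanishes_first_def\<close>)
qed

text \<open>For late approximations \<open>0\<close> belongs to the first and \<open>1\<close> to the second of two disjoint open sets, so
  the interval \<open>[0, 1]\<close> is not covered by them. A limit of parameters outside both gives the solution;
  it cannot be \<open>0\<close> or \<open>1\<close>, where one component does vanish strictly first.\<close>
lemma balanced_pair_exists:
  assumes crit: "\<kappa> / (s + 1) > (\<kappa> - 1) / 2"
  obtains t u v P Q where "0 < t" "t < 1" "weighted_pair \<kappa> s \<delta> \<mu> (1 - t) t u v P Q"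
    "\<forall>x\<ge>0. \<not> (u x < 0 \<and> v x > 0)" "\<forall>x\<ge>0. \<not> (v x < 0 \<and> u x > 0)"
proof -
  obtain r1 where r1: "strict_mono (r1 :: nat \<Rightarrow> nat)" "\<forall>\<^sub>F k in sequentially. 0 \<in> fst_vanishes_first (r1 k)"
  proof -
    have id: "strict_mono (\<lambda>k::nat. k)" and zero: "0 \<in> {0..1::real}" for k :: nat
      by (auto simp: strict_mono_def)
    obtain r t u v P Q where *: "strict_mono (r :: nat \<Rightarrow> nat)" "t \<in> {0..1}" "(\<lambda>k. 0) \<longlonglongrightarrow> (t::real)"
      "weighted_pair \<kappa> s \<delta> \<mu> (1 - t) t u v P Q"
      "\<forall>x\<ge>0. (\<lambda>k. fst (approx (r k) 0 x)) \<longlonglongrightarrow> u x"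
      "\<forall>x\<ge>0. (\<lambda>k. snd (approx (r k) 0 x)) \<longlonglongrightarrow> v x"
      by (rule weighted_pair_limit[where \<rho> = "\<lambda>k. k" and \<tau> = "\<lambda>_. 0", OF id zero]) (rule that)
    have "t = 0" using *(3) by (metis LIMSEQ_const_iff)
    then obtain x where "x > 0" "u x < 0" "v x > 0"
      using weighted_pair_degenerate[of \<kappa> s \<delta> \<mu> u v P Q] *(4) exponents crit by auto
    then have "\<forall>\<^sub>F k in sequentially. 0 \<in> fst_vanishes_first (r k)"
      using eventually_vanishes_first(1)[where n = r and \<tau> = "\<lambda>_. 0"] *(5,6) less_imp_le by metis
    with *(1) show thesis by (rule that)
  qed
  obtain r2 where r2: "strict_mono (r2 :: nat \<Rightarrow> nat)"
    "\<forall>\<^sub>F k in sequentially. 1 \<in> snd_vanishes_first (r1 (r2 k))"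
  proof -
    have one: "1 \<in> {0..1::real}" for k :: nat by simp
    obtain r t u v P Q where *: "strict_mono (r :: nat \<Rightarrow> nat)" "t \<in> {0..1}" "(\<lambda>k. 1) \<longlonglongrightarrow> (t::real)"
      "weighted_pair \<kappa> s \<delta> \<mu> (1 - t) t u v P Q"
      "\<forall>x\<ge>0. (\<lambda>k. fst (approx (r1 (r k)) 1 x)) \<longlonglongrightarrow> u x"
      "\<forall>x\<ge>0. (\<lambda>k. snd (approx (r1 (r k)) 1 x)) \<longlonglongrightarrow> v x"
      by (rule weighted_pair_limit[where \<rho> = r1 and \<tau> = "\<lambda>_. 1", OF r1(1) one]) (rule that)
    have "t = 1" using *(3) by (metis LIMSEQ_const_iff)
    then obtain x where "x > 0" "v x < 0" "u x > 0"
      using weighted_pair_degenerate[OF weighted_pair_swap, of \<kappa> s \<delta> \<mu> u v P Q] *(4) exponents crit by auto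
    then have "\<forall>\<^sub>F k in sequentially. 1 \<in> snd_vanishes_first (r1 (r k))"
      using eventually_vanishes_first(2)[where n = "\<lambda>k. r1 (r k)" and \<tau> = "\<lambda>_. 1"] *(5,6) less_imp_le by metis
    with *(1) show thesis by (rule that)
  qed
  define \<rho> where "\<rho> = r1 \<circ> r2"
  have \<rho>: "strict_mono \<rho>" unfolding \<rho>_def using r1(1) r2(1) by (rule strict_mono_o)
  have "\<forall>\<^sub>F k in sequentially. 0 \<in> fst_vanishes_first (\<rho> k)"
    using eventually_compose_filterlim[OF r1(2) filterlim_subseq[OF r2(1)]] by (simp add: \<rho>_def)
  with r2(2) have ev: "\<forall>\<^sub>F k in sequentially. \<exists>\<tau>\<in>{0..1}. \<tau> \<notin> fst_vanishes_first (\<rho> k) \<and> \<tau> \<notin> snd_vanishes_first (\<rho> k)"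
  proof eventually_elim
    case (elim k)
    show ?case
    proof (rule ccontr)
      assume "\<not> ?case"
      then have "{0..1} \<subseteq> fst_vanishes_first (\<rho> k) \<union> snd_vanishes_first (\<rho> k)" by blast
      moreover have "0 \<in> fst_vanishes_first (\<rho> k) \<inter> {0..1}" "1 \<in> snd_vanishes_first (\<rho> k) \<inter> {0..1}"
        using elim by (auto simp: \<rho>_def)
      ultimately show False
        using connectedD[OF connected_Icc[of 0 "1::real"] open_vanishes_first[of "\<rho> k"]] disjoint_vanishes_first[of "\<rho> k"]
        by blast
    qed
  qed
  let ?G = "\<lambda>k \<tau>. \<tau> \<notin> fst_vanishes_first (\<rho> k) \<and> \<tau> \<notin> snd_vanishes_first (\<rho> k)"
  have "\<exists>t. t \<in> {0..1::real} \<and> ((\<exists>\<tau>\<in>{0..1}. ?G k \<tau>) \<longrightarrow> ?G k t)" for k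
  proof (cases "\<exists>\<tau>\<in>{0..1}. ?G k \<tau>")
    case False
    then show ?thesis by (intro exI[of _ "0::real"] conjI impI) (simp, blast, blast)
  qed blast
  then have "\<exists>\<tau>. \<forall>k. \<tau> k \<in> {0..1::real} \<and> ((\<exists>\<tau>\<in>{0..1}. ?G k \<tau>) \<longrightarrow> ?G k (\<tau> k))"
    by (intro choice) blast
  then obtain \<tau> where \<tau>01: "\<tau> k \<in> {0..1::real}" and \<tau>: "\<exists>\<tau>\<in>{0..1}. ?G k \<tau> \<Longrightarrow> ?G k (\<tau> k)" for k
    by blast
  obtain r t u v P Q where r: "strict_mono (r :: nat \<Rightarrow> nat)" "t \<in> {0..1}"
    and pair: "weighted_pair \<kappa> s \<delta> \<mu> (1 - t) t u v P Q"
    and lim: "\<forall>x\<ge>0. (\<lambda>k. fst (approx (\<rho> (r k)) (\<tau> (r k)) x)) \<longlonglongrightarrow> u x"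
      "\<forall>x\<ge>0. (\<lambda>k. snd (approx (\<rho> (r k)) (\<tau> (r k)) x)) \<longlonglongrightarrow> v x"
    by (rule weighted_pair_limit[where \<rho> = \<rho> and \<tau> = \<tau>, OF \<rho> \<tau>01]) (rule that)
  have ev': "\<forall>\<^sub>F k in sequentially. \<tau> (r k) \<notin> fst_vanishes_first (\<rho> (r k)) \<and> \<tau> (r k) \<notin> snd_vanishes_first (\<rho> (r k))"
    using eventually_compose_filterlim[OF ev filterlim_subseq[OF r(1)]]
    by eventually_elim (use \<tau> in auto)
  have n1: "\<not> (u x < 0 \<and> v x > 0)" if "x \<ge> 0" for x
  proof
    assume "u x < 0 \<and> v x > 0"
    then have "\<forall>\<^sub>F k in sequentially. \<tau> (r k) \<in> fst_vanishes_first (\<rho> (r k))"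
      using eventually_vanishes_first(1)[where n = "\<lambda>k. \<rho> (r k)" and \<tau> = "\<lambda>k. \<tau> (r k)", OF lim[rule_format, OF that] that] by simp
    with ev' have "\<forall>\<^sub>F k in sequentially. False" by eventually_elim auto
    then show False by simp
  qed
  have n2: "\<not> (v x < 0 \<and> u x > 0)" if "x \<ge> 0" for x
  proof
    assume "v x < 0 \<and> u x > 0"
    then have "\<forall>\<^sub>F k in sequentially. \<tau> (r k) \<in> snd_vanishes_first (\<rho> (r k))"
      using eventually_vanishes_first(2)[where n = "\<lambda>k. \<rho> (r k)" and \<tau> = "\<lambda>k. \<tau> (r k)", OF lim[rule_format, OF that] that] by simp
    with ev' have "\<forall>\<^sub>F k in sequentially. False" by eventually_elim auto
    then show False by simp
  qed
  have "t \<noteq> 0"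
    using weighted_pair_degenerate[of \<kappa> s \<delta> \<mu> u v P Q] pair exponents crit n1 by force
  moreover have "t \<noteq> 1"
    using weighted_pair_degenerate[OF weighted_pair_swap, of \<kappa> s \<delta> \<mu> u v P Q] pair exponents crit n2
    by force
  ultimately show thesis using that[of t, OF _ _ pair] n1 n2 r(2) by auto
qed

end

text \<open>The factors must satisfy \<open>\<alpha>\<^bsup>s-1\<^esup> \<beta>\<^sup>\<delta> = c\<close> and \<open>\<alpha>\<^sup>\<mu> \<beta>\<^bsup>s-1\<^esup> = d\<close>. In logarithms this is a linear system of
  determinant \<open>(s-1)\<^sup>2 - \<delta>\<mu>\<close>, and it is solved by Cramer's rule.\<close>
lemma weighted_pair_rescale:
  assumes pair: "weighted_pair \<kappa> s \<delta> \<mu> c d u v P Q" and cd: "c > 0" "d > 0"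
    and D: "\<delta> * \<mu> - (1 - s)\<^sup>2 > 0"
  obtains \<alpha> \<beta> where "\<alpha> > 0" "\<beta> > 0"
    "radial_poisson \<kappa> (power_source s \<delta> (\<lambda>x. \<alpha> * u x) (\<lambda>x. \<beta> * v x)) (\<lambda>x. \<alpha> * u x) (\<lambda>x. \<alpha> * P x)"
    "radial_poisson \<kappa> (power_source s \<mu> (\<lambda>x. \<beta> * v x) (\<lambda>x. \<alpha> * u x)) (\<lambda>x. \<beta> * v x) (\<lambda>x. \<beta> * Q x)"
proof -
  define D where "D = (s - 1) * (s - 1) - \<delta> * \<mu>"
  have D: "D \<noteq> 0" using D by (simp add: D_def power2_eq_square algebra_simps)
  define a b where "a = ((s - 1) * ln c - \<delta> * ln d) / D" and "b = ((s - 1) * ln d - \<mu> * ln c) / D"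
  define \<alpha> \<beta> where "\<alpha> = exp a" and "\<beta> = exp b"
  have 1: "(s - 1) * a + \<delta> * b = ln c"
  proof -
    have "((s - 1) * a + \<delta> * b) * D = ln c * D"
      using D by (simp add: a_def b_def distrib_right) (simp add: D_def algebra_simps)
    then show ?thesis using D by simp
  qed
  have 2: "\<mu> * a + (s - 1) * b = ln d"
  proof -
    have "(\<mu> * a + (s - 1) * b) * D = ln d * D"
      using D by (simp add: a_def b_def distrib_right) (simp add: D_def algebra_simps)
    then show ?thesis using D by simp
  qed
  have pos: "\<alpha> > 0" "\<beta> > 0" by (auto simp: \<alpha>_def \<beta>_def)
  have ca: "\<alpha> powr s * \<beta> powr \<delta> = \<alpha> * c"
  proof -
    have "\<alpha> powr s * \<beta> powr \<delta> = exp (s * a + \<delta> * b)" by (simp add: \<alpha>_def \<beta>_def powr_def exp_add)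
    also have "s * a + \<delta> * b = a + ln c" using 1 by (simp add: algebra_simps)
    finally show ?thesis using cd by (simp add: exp_add \<alpha>_def)
  qed
  have db: "\<beta> powr s * \<alpha> powr \<mu> = \<beta> * d"
  proof -
    have "\<beta> powr s * \<alpha> powr \<mu> = exp (s * b + \<mu> * a)" by (simp add: \<alpha>_def \<beta>_def powr_def exp_add)
    also have "s * b + \<mu> * a = b + ln d" using 2 by (simp add: algebra_simps)
    finally show ?thesis using cd by (simp add: exp_add \<beta>_def)
  qed
  have mx: "max 0 (e * z) = e * max 0 z" if "e > 0" for e z :: real
    using that by (auto simp: max_def mult_le_0_iff zero_le_mult_iff)
  have sf: "power_source s \<delta> (\<lambda>x. \<alpha> * u x) (\<lambda>x. \<beta> * v x) x = \<alpha> * (c * power_source s \<delta> u v x)" for x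
  proof -
    have "power_source s \<delta> (\<lambda>x. \<alpha> * u x) (\<lambda>x. \<beta> * v x) x = (\<alpha> powr s * \<beta> powr \<delta>) * power_source s \<delta> u v x"
      using pos by (simp add: power_source_def mx powr_mult)
    then show ?thesis by (simp add: ca)
  qed
  have sg: "power_source s \<mu> (\<lambda>x. \<beta> * v x) (\<lambda>x. \<alpha> * u x) x = \<beta> * (d * power_source s \<mu> v u x)" for x
  proof -
    have "power_source s \<mu> (\<lambda>x. \<beta> * v x) (\<lambda>x. \<alpha> * u x) x = (\<beta> powr s * \<alpha> powr \<mu>) * power_source s \<mu> v u x"
      using pos by (simp add: power_source_def mx powr_mult)
    then show ?thesis by (simp add: db)
  qed
  show thesis
  proof (rule that[OF pos])
    show "radial_poisson \<kappa> (power_source s \<delta> (\<lambda>x. \<alpha> * u x) (\<lambda>x. \<beta> * v x)) (\<lambda>x. \<alpha> * u x) (\<lambda>x. \<alpha> * P x)"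
      by (rule radial_poisson_cong[OF radial_poisson_scale]) (use pair sf in \<open>auto simp: weighted_pair_def\<close>)
    show "radial_poisson \<kappa> (power_source s \<mu> (\<lambda>x. \<beta> * v x) (\<lambda>x. \<alpha> * u x)) (\<lambda>x. \<beta> * v x) (\<lambda>x. \<beta> * Q x)"
      by (rule radial_poisson_cong[OF radial_poisson_scale]) (use pair sg in \<open>auto simp: weighted_pair_def\<close>)
  qed
qed

lemma positive_or_positive_pair:
  assumes "\<kappa> > 1" "s > 0" "\<delta> > 0" "\<mu> > 0"
    and "radial_poisson \<kappa> (power_source s \<delta> u v) u P" "radial_poisson \<kappa> (power_source s \<mu> v u) v Q"
    and "u 0 > 0" "v 0 > 0"
  obtains "\<And>x. x \<ge> 0 \<Longrightarrow> u x > 0 \<and> v x > 0"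
  | L where "positive_pair \<kappa> s \<delta> \<mu> L u v P Q" "min (u L) (v L) = 0"
proof -
  have "continuous_on {0..} (\<lambda>x. min (u x) (v x))"
    by (intro continuous_on_min radial_poissonD(1)[OF assms(5)] radial_poissonD(1)[OF assms(6)])
  then show thesis
  proof (rule positive_or_first_zero)
    show "min (u 0) (v 0) > 0" using assms by simp
    assume "\<And>x. 0 \<le> x \<Longrightarrow> 0 < min (u x) (v x)"
    then show thesis using that(1) by simp
  next
    fix L assume L: "0 < L" "min (u L) (v L) = 0" "\<And>x. 0 \<le> x \<Longrightarrow> x < L \<Longrightarrow> 0 < min (u x) (v x)"
    have "positive_pair \<kappa> s \<delta> \<mu> L u v P Q"
      by unfold_locales (use assms L in auto)
    then show thesis using that(2) L by simp
  qed
qed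

text \<open>In the supercritical case any choice of coefficients works. In the subcritical case a solution
  for which no component vanishes strictly first could only have a simultaneous zero.\<close>
theorem entire_positive_pair:
  fixes \<kappa> s \<delta> \<mu> :: real
  assumes exps: "\<kappa> > 1" "s > 0" "\<delta> > 0" "\<mu> > 0" and D: "\<delta> * \<mu> - (1 - s)\<^sup>2 > 0"
    and above: "\<kappa> / (\<mu> + 1) + \<kappa> / (\<delta> + 1)
      < (\<kappa> - 1) + (\<kappa> - 1) * s / 2 * min (1 / (\<mu> + 1)) (1 / (\<delta> + 1))"
  obtains u v P Q where "radial_poisson \<kappa> (power_source s \<delta> u v) u P"
    "radial_poisson \<kappa> (power_source s \<mu> v u) v Q" "\<forall>x\<ge>0. u x > 0 \<and> v x > 0"
proof (cases "\<kappa> / (s + 1) \<le> (\<kappa> - 1) / 2")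
  case True
  obtain u v P Q where pair: "weighted_pair \<kappa> s \<delta> \<mu> (1/2) (1/2) u v P Q"
    using weighted_pair_exists[OF exps] by auto
  obtain \<alpha> \<beta> where ab: "\<alpha> > 0" "\<beta> > 0" and eqs:
    "radial_poisson \<kappa> (power_source s \<delta> (\<lambda>x. \<alpha> * u x) (\<lambda>x. \<beta> * v x)) (\<lambda>x. \<alpha> * u x) (\<lambda>x. \<alpha> * P x)"
    "radial_poisson \<kappa> (power_source s \<mu> (\<lambda>x. \<beta> * v x) (\<lambda>x. \<alpha> * u x)) (\<lambda>x. \<beta> * v x) (\<lambda>x. \<beta> * Q x)"
    by (rule weighted_pair_rescale[OF pair _ _ D]) auto
  have init: "\<alpha> * u 0 > 0" "\<beta> * v 0 > 0" using ab pair by (auto simp: weighted_pair_def)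
  from exps eqs init show thesis
  proof (rule positive_or_positive_pair)
    assume "\<And>x. 0 \<le> x \<Longrightarrow> 0 < \<alpha> * u x \<and> 0 < \<beta> * v x"
    then show thesis by (intro that[OF eqs]) blast
  next
    fix L assume L: "positive_pair \<kappa> s \<delta> \<mu> L (\<lambda>x. \<alpha> * u x) (\<lambda>x. \<beta> * v x) (\<lambda>x. \<alpha> * P x) (\<lambda>x. \<beta> * Q x)"
      "min (\<alpha> * u L) (\<beta> * v L) = 0"
    then have "\<alpha> * u L = 0 \<or> \<beta> * v L = 0" by (auto simp: min_def split: if_splits)
    then show thesis
      using positive_pair.no_zero_supercritical[OF L(1) True]
        positive_pair.no_zero_supercritical[OF positive_pair.swap[OF L(1)] True] by blast
  qed
next
  case False
  then have crit: "\<kappa> / (s + 1) > (\<kappa> - 1) / 2" by simp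
  obtain t u v P Q where t: "0 < t" "t < 1" and pair: "weighted_pair \<kappa> s \<delta> \<mu> (1 - t) t u v P Q"
    and bal: "\<forall>x\<ge>0. \<not> (u x < 0 \<and> v x > 0)" "\<forall>x\<ge>0. \<not> (v x < 0 \<and> u x > 0)"
    by (rule balanced_pair_exists[OF exps crit]) (rule that)
  obtain \<alpha> \<beta> where ab: "\<alpha> > 0" "\<beta> > 0" and eqs:
    "radial_poisson \<kappa> (power_source s \<delta> (\<lambda>x. \<alpha> * u x) (\<lambda>x. \<beta> * v x)) (\<lambda>x. \<alpha> * u x) (\<lambda>x. \<alpha> * P x)"
    "radial_poisson \<kappa> (power_source s \<mu> (\<lambda>x. \<beta> * v x) (\<lambda>x. \<alpha> * u x)) (\<lambda>x. \<beta> * v x) (\<lambda>x. \<beta> * Q x)"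
    by (rule weighted_pair_rescale[OF pair _ _ D]) (use t in auto)
  have init: "\<alpha> * u 0 > 0" "\<beta> * v 0 > 0" using ab pair by (auto simp: weighted_pair_def)
  from exps eqs init show thesis
  proof (rule positive_or_positive_pair)
    assume "\<And>x. 0 \<le> x \<Longrightarrow> 0 < \<alpha> * u x \<and> 0 < \<beta> * v x"
    then show thesis by (intro that[OF eqs]) blast
  next
    fix L assume L: "positive_pair \<kappa> s \<delta> \<mu> L (\<lambda>x. \<alpha> * u x) (\<lambda>x. \<beta> * v x) (\<lambda>x. \<alpha> * P x) (\<lambda>x. \<beta> * Q x)"
      and z: "min (\<alpha> * u L) (\<beta> * v L) = 0"
    interpret pp: positive_pair \<kappa> s \<delta> \<mu> L "\<lambda>x. \<alpha> * u x" "\<lambda>x. \<beta> * v x" "\<lambda>x. \<alpha> * P x" "\<lambda>x. \<beta> * Q x" by fact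
    have "\<alpha> * u L = 0 \<and> \<beta> * v L = 0"
    proof (rule ccontr)
      assume "\<not> ?thesis"
      moreover have "y = 0 \<and> z > 0 \<or> z = 0 \<and> y > 0" if "min y z = 0" "\<not> (y = 0 \<and> z = 0)" for y z :: real
        using that by (auto simp: min_def split: if_splits)
      ultimately consider "\<alpha> * u L = 0" "\<beta> * v L > 0" | "\<beta> * v L = 0" "\<alpha> * u L > 0"
        using z by blast
      then show False
      proof cases
        case 1
        from pp.crosses_below_zero[OF 1] show False using bal(1) ab
          by (auto simp: mult_less_0_iff zero_less_mult_iff)
      next
        case 2
        from positive_pair.crosses_below_zero[OF pp.swap 2] show False using bal(2) ab
          by (auto simp: mult_less_0_iff zero_less_mult_iff)
      qed
    qed
    then show thesis using pp.no_simultaneous_zero[OF above] by blast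
  qed
qed

section \<open>From the radial system to Euclidean space\<close>

text \<open>Along \<open>x + t b\<close> the norm is \<open>sqrt (r\<^sup>2 + 2 t (x \<bullet> b) + t\<^sup>2)\<close>; summing the second derivatives over the basis
  uses \<open>\<Sum>b (x \<bullet> b)\<^sup>2 = r\<^sup>2\<close>.\<close>
lemma laplacian_radial:
  fixes x :: "'n::euclidean_space" and U :: "real \<Rightarrow> real"
  assumes U: "\<And>r. r > 0 \<Longrightarrow> (U has_real_derivative U' r) (at r)"
    and U': "\<And>r. r > 0 \<Longrightarrow> (U' has_real_derivative U'' r) (at r)"
    and x: "x \<noteq> 0"
  shows "laplacian (\<lambda>y. U (norm y)) x
    = U'' (norm x) + (real DIM('n) - 1) / norm x * U' (norm x)"
proof -
  define r where "r = norm x"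
  have r: "r > 0" using x by (simp add: r_def)
  have second: "(deriv ^^ 2) (\<lambda>t. U (norm (x + t *\<^sub>R b))) 0
      = U'' r * (x \<bullet> b)\<^sup>2 / r\<^sup>2 + U' r * (1 / r - (x \<bullet> b)\<^sup>2 / r ^ 3)" if b: "b \<in> Basis" for b :: 'n
  proof -
    define B where "B = x \<bullet> b"
    define q where "q t = r\<^sup>2 + 2 * t * B + t\<^sup>2" for t
    define N where "N t = sqrt (q t)" for t
    have N: "norm (x + t *\<^sub>R b) = N t" for t
    proof -
      have "(norm (x + t *\<^sub>R b))\<^sup>2 = q t"
        using b unfolding q_def r_def B_def power2_norm_eq_inner
        by (simp add: inner_add_left inner_add_right inner_commute power2_eq_square algebra_simps)
      then show ?thesis unfolding N_def by (metis norm_ge_zero real_sqrt_unique)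
    qed
    have N0: "N 0 = r" using r by (simp add: N_def q_def)
    define T where "T = {t. q t > 0}"
    have T: "open T" "0 \<in> T"
    proof -
      show "open T" unfolding T_def q_def by (intro open_Collect_less continuous_intros)
      show "0 \<in> T" using r by (simp add: T_def q_def)
    qed
    have Npos: "N t > 0" if "t \<in> T" for t using that by (simp add: N_def T_def)
    have N': "(N has_real_derivative (B + t) / N t) (at t)" if "t \<in> T" for t
    proof -
      have "(q has_real_derivative 2 * (B + t)) (at t)"
        unfolding q_def by (auto intro!: derivative_eq_intros)
      moreover have "q t > 0" using that by (simp add: T_def)
      ultimately show ?thesis
        unfolding N_def by (auto intro!: derivative_eq_intros simp: field_simps)
    qed
    have d1: "((\<lambda>t. U (N t)) has_real_derivative U' (N t) * ((B + t) / N t)) (at t)" if "t \<in> T" for t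
      using DERIV_chain2[OF U[OF Npos[OF that]] N'[OF that]] .
    have "\<forall>\<^sub>F t in nhds 0. t \<in> T" using T by (rule eventually_nhds_in_open)
    then have ev: "\<forall>\<^sub>F t in nhds 0. deriv (\<lambda>t. U (N t)) t = U' (N t) * ((B + t) / N t)"
      by eventually_elim (rule DERIV_imp_deriv, rule d1)
    have n0: "N 0 \<noteq> 0" using N0 r by simp
    have "((\<lambda>t. U' (N t) * ((B + t) / N t)) has_real_derivative
        U'' r * (B / r) * (B / r) + (r - B * (B / r)) / (r * r) * U' r) (at 0)"
    proof -
      have "((\<lambda>t. (B + t) / N t) has_real_derivative
          (1 * N 0 - (B + 0) * ((B + 0) / N 0)) / (N 0 * N 0)) (at 0)"
        by (intro DERIV_divide N' T n0) (auto intro!: derivative_eq_intros)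
      from DERIV_mult[OF DERIV_chain2[OF U'[OF Npos[OF T(2)]] N'[OF T(2)]] this]
      show ?thesis by (simp add: N0)
    qed
    then have "((deriv (\<lambda>t. U (N t))) has_real_derivative
        U'' r * (B / r) * (B / r) + (r - B * (B / r)) / (r * r) * U' r) (at 0)"
      using DERIV_cong_ev[OF refl ev refl] by simp
    then have "deriv (deriv (\<lambda>t. U (N t))) 0
        = U'' r * (B / r) * (B / r) + (r - B * (B / r)) / (r * r) * U' r"
      by (rule DERIV_imp_deriv)
    also have "\<dots> = U'' r * B\<^sup>2 / r\<^sup>2 + U' r * (1 / r - B\<^sup>2 / r ^ 3)"
      using r by (simp add: field_simps power2_eq_square power3_eq_cube)
    finally show ?thesis by (simp add: N B_def numeral_2_eq_2)
  qed
  have sq: "(\<Sum>b\<in>Basis. (x \<bullet> b)\<^sup>2) = r\<^sup>2"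
    unfolding r_def power2_norm_eq_inner by (subst euclidean_inner) (simp add: power2_eq_square)
  have "laplacian (\<lambda>y. U (norm y)) x
      = (\<Sum>b\<in>Basis. U'' r * (x \<bullet> b)\<^sup>2 / r\<^sup>2 + U' r * (1 / r - (x \<bullet> b)\<^sup>2 / r ^ 3))"
    unfolding laplacian_def by (intro sum.cong refl second)
  also have "\<dots> = U'' r / r\<^sup>2 * (\<Sum>b\<in>Basis. (x \<bullet> b)\<^sup>2)
      + U' r * (real DIM('n) / r - (\<Sum>b\<in>Basis. (x \<bullet> b)\<^sup>2) / r ^ 3)"
    by (simp add: sum.distrib sum_subtractf flip: sum_distrib_left sum_divide_distrib)
  also have "\<dots> = U'' r + (real DIM('n) - 1) / r * U' r"
    unfolding sq using r by (simp add: field_simps power2_eq_square power3_eq_cube)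
  finally show ?thesis by (simp add: r_def)
qed

text \<open>The factor \<open>1/\<beta>\<^sup>2\<close> normalises the coefficient of the transformed source to \<open>1\<close>.\<close>
definition emden_radius :: "real \<Rightarrow> real \<Rightarrow> real" where
  "emden_radius \<beta> r = r powr \<beta> / \<beta>\<^sup>2"

lemma emden_radius_pos: "\<beta> > 0 \<Longrightarrow> r > 0 \<Longrightarrow> emden_radius \<beta> r > 0"
  by (simp add: emden_radius_def)

lemma emden_radius_nonneg: "emden_radius \<beta> r \<ge> 0"
  by (simp add: emden_radius_def)

lemma continuous_emden_radius: "\<beta> > 0 \<Longrightarrow> continuous_on {0..} (emden_radius \<beta>)"
  unfolding emden_radius_def by (intro continuous_intros continuous_on_powr_0) auto

lemma emden_radius_derivative:
  "\<beta> > 0 \<Longrightarrow> r > 0 \<Longrightarrow> (emden_radius \<beta> has_real_derivative r powr (\<beta> - 1) / \<beta>) (at r)"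
  unfolding emden_radius_def
  by (auto intro!: derivative_eq_intros simp: power2_eq_square field_simps)

text \<open>With \<open>r = |x|\<close> and \<open>X\<close> the new variable, \<open>(dX/dr)\<^sup>2 / X = r\<^sup>a\<close>: this produces the weight in front of the source,
  and \<open>\<kappa> \<beta> = N + a\<close> is exactly what cancels the first-order terms.\<close>
lemma radial_poisson_pullback:
  fixes a \<kappa> \<beta> :: real and f u P :: "real \<Rightarrow> real"
  defines "U \<equiv> \<lambda>r. u (emden_radius \<beta> r)"
  assumes \<beta>: "\<beta> = 2 + a" "\<beta> > 0" and \<kappa>: "\<kappa> * \<beta> = real DIM('n::euclidean_space) + a"
    and u: "radial_poisson \<kappa> f u P" and f: "continuous_on {0..} f"
  shows "C2_on {0<..} U" "continuous_on {0..} U"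
    "\<And>x::'n. x \<noteq> 0 \<Longrightarrow> - laplacian (\<lambda>y. U (norm y)) x = norm x powr a * f (emden_radius \<beta> (norm x))"
proof -
  let ?X = "emden_radius \<beta>"
  define U' where "U' r = - P (?X r) * (r powr (\<beta> - 1) / \<beta>)" for r
  define U'' where "U'' r = - (r powr a) * (f (?X r) - \<kappa> * P (?X r) + (\<beta> - 1) / \<beta> * P (?X r))" for r
  note X_pos = emden_radius_pos[OF \<beta>(2)] and X' = emden_radius_derivative[OF \<beta>(2)]
  have d1: "(U has_real_derivative U' r) (at r)" if r: "r > 0" for r
    unfolding U_def U'_def by (rule DERIV_chain2[OF radial_poissonD(3)[OF u X_pos[OF r]] X'[OF r]])
  have d2: "(U' has_real_derivative U'' r) (at r)" if r: "r > 0" for r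
  proof -
    have p1: "r powr (\<beta> - 1) = r * r powr a" and p2: "r powr \<beta> = r * r * r powr a"
      and p3: "r powr (\<beta> - 1 - 1) = r powr a"
      using r by (simp_all add: \<beta>(1) powr_add power2_eq_square)
    have Pd: "((\<lambda>r. P (?X r)) has_real_derivative
        (f (?X r) - \<kappa> * P (?X r)) / ?X r * (r powr (\<beta> - 1) / \<beta>)) (at r)"
      by (rule DERIV_chain2[OF radial_poissonD(4)[OF u X_pos[OF r]] X'[OF r]])
    have Wd: "((\<lambda>r. r powr (\<beta> - 1) / \<beta>) has_real_derivative (\<beta> - 1) * r powr (\<beta> - 1 - 1) / \<beta>) (at r)"
      using r \<beta>(2) by (auto intro!: derivative_eq_intros)
    have "(U' has_real_derivative
        - ((f (?X r) - \<kappa> * P (?X r)) / ?X r * (r powr (\<beta> - 1) / \<beta>)) * (r powr (\<beta> - 1) / \<beta>)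
        + ((\<beta> - 1) * r powr (\<beta> - 1 - 1) / \<beta>) * - P (?X r)) (at r)"
      unfolding U'_def[abs_def] by (intro DERIV_mult DERIV_minus Pd Wd)
    also have "- ((f (?X r) - \<kappa> * P (?X r)) / ?X r * (r powr (\<beta> - 1) / \<beta>)) * (r powr (\<beta> - 1) / \<beta>)
        = - (r powr a) * (f (?X r) - \<kappa> * P (?X r))"
    proof -
      have "(r powr (\<beta> - 1) / \<beta>) * (r powr (\<beta> - 1) / \<beta>) = r powr a * ?X r"
        using \<beta>(2) unfolding emden_radius_def p1 p2 by (simp add: power2_eq_square)
      then have "(f (?X r) - \<kappa> * P (?X r)) / ?X r * (r powr (\<beta> - 1) / \<beta>) * (r powr (\<beta> - 1) / \<beta>)
          = (f (?X r) - \<kappa> * P (?X r)) / ?X r * (r powr a * ?X r)"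
        by (simp only: mult.assoc)
      also have "\<dots> = r powr a * (f (?X r) - \<kappa> * P (?X r))" using X_pos[OF r] by simp
      finally show ?thesis by simp
    qed
    also have "- (r powr a) * (f (?X r) - \<kappa> * P (?X r)) + ((\<beta> - 1) * r powr (\<beta> - 1 - 1) / \<beta>) * - P (?X r) = U'' r"
      unfolding U''_def p3 by (simp add: algebra_simps)
    finally show ?thesis .
  qed
  have contX: "continuous_on {0<..} ?X"
    by (rule continuous_on_subset[OF continuous_emden_radius[OF \<beta>(2)]]) auto
  show "continuous_on {0..} U"
    unfolding U_def
    by (rule continuous_on_compose2[OF radial_poissonD(1)[OF u] continuous_emden_radius[OF \<beta>(2)]])
       (auto simp: emden_radius_nonneg)
  show "C2_on {0<..} U"
    unfolding C2_on_def
  proof (intro conjI ballI)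
    fix r :: real assume "r \<in> {0<..}"
    then have r: "r > 0" by simp
    show "U field_differentiable at r" using d1[OF r] by (auto simp: field_differentiable_def)
    have ev: "\<forall>\<^sub>F t in nhds r. deriv U t = U' t"
      using eventually_nhds_in_open[of "{0<..}" r] r
      by (auto elim!: eventually_mono intro!: DERIV_imp_deriv d1)
    then have "(deriv U has_real_derivative U'' r) (at r)"
      using DERIV_cong_ev[OF refl ev refl] d2[OF r] by simp
    then show "deriv U field_differentiable at r" by (auto simp: field_differentiable_def)
  next
    have "continuous_on {0<..} (\<lambda>r. f (?X r))" "continuous_on {0<..} (\<lambda>r. P (?X r))"
      by (rule continuous_on_compose2[OF f contX] continuous_on_compose2[OF radial_poissonD(2)[OF u] contX];
          auto simp: emden_radius_nonneg)+
    then have "continuous_on {0<..} U''"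
      unfolding U''_def by (intro continuous_intros) auto
    then show "continuous_on {0<..} (deriv (deriv U))"
    proof (rule continuous_on_cong[THEN iffD1, rotated 2])
      fix r :: real assume "r \<in> {0<..}"
      then have r: "r > 0" by simp
      have ev: "\<forall>\<^sub>F t in nhds r. deriv U t = U' t"
        using eventually_nhds_in_open[of "{0<..}" r] r
        by (auto elim!: eventually_mono intro!: DERIV_imp_deriv d1)
      then have "(deriv U has_real_derivative U'' r) (at r)"
        using DERIV_cong_ev[OF refl ev refl] d2[OF r] by simp
      then show "U'' r = deriv (deriv U) r" by (simp add: DERIV_imp_deriv)
    qed simp
  qed
  fix x :: 'n assume x: "x \<noteq> 0"
  define r where "r = norm x"
  have r: "r > 0" using x by (simp add: r_def)
  have "laplacian (\<lambda>y. U (norm y)) x = U'' r + (real DIM('n) - 1) / r * U' r"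
    unfolding r_def by (rule laplacian_radial[OF d1 d2 x])
  also have "(real DIM('n) - 1) / r * U' r = - (r powr a) * ((real DIM('n) - 1) / \<beta> * P (?X r))"
  proof -
    have "r powr (\<beta> - 1) = r * r powr a" using r by (simp add: \<beta>(1) powr_add)
    then show ?thesis using r by (simp add: U'_def)
  qed
  also have "U'' r + - (r powr a) * ((real DIM('n) - 1) / \<beta> * P (?X r))
      = - (r powr a) * (f (?X r) + ((\<beta> - 1) / \<beta> + (real DIM('n) - 1) / \<beta> - \<kappa>) * P (?X r))"
    unfolding U''_def by (simp add: algebra_simps)
  also have "(\<beta> - 1) / \<beta> + (real DIM('n) - 1) / \<beta> - \<kappa> = 0"
  proof -
    have "(\<beta> - 1) + (real DIM('n) - 1) = \<kappa> * \<beta>" using \<kappa> \<beta>(1) by simp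
    then have "(\<beta> - 1) / \<beta> + (real DIM('n) - 1) / \<beta> = \<kappa>"
      using \<beta>(2) by (simp flip: add_divide_distrib)
    then show ?thesis by simp
  qed
  finally show "- laplacian (\<lambda>y. U (norm y)) x = norm x powr a * f (?X (norm x))"
    by (simp add: r_def)
qed

lemma curve_subset_under_hyperbola:
  assumes "N > 2" "s > 0"
  shows "curve_C N a s \<subseteq> under_hyperbola N a"
proof
  fix p assume "p \<in> curve_C N a s"
  then obtain \<delta> \<mu> where p: "p = (\<delta>, \<mu>)" "\<delta> > 0" "\<mu> > 0" and
    eq: "(N + a) / (\<mu> + 1) + (N + a) / (\<delta> + 1)
       = N - 2 + (N - 2) * s / 2 * min (1 / (\<mu> + 1)) (1 / (\<delta> + 1))"
    by (auto simp: curve_C_def)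
  have "(N - 2) * s / 2 * min (1 / (\<mu> + 1)) (1 / (\<delta> + 1)) > 0"
    using assms p by (intro mult_pos_pos divide_pos_pos) (auto simp: min_def)
  then show "p \<in> under_hyperbola N a"
    using eq p by (simp add: under_hyperbola_def)
qed

text \<open>Multiplying the inequality between the exponents by \<open>\<beta> = 2 + a\<close> turns it into the definition of the region
  above the curve, since \<open>\<kappa> \<beta> = N + a\<close> and \<open>(\<kappa> - 1) \<beta> = N - 2\<close>.\<close>
theorem ground_state_above_C:
  assumes N: "DIM('n::euclidean_space) > 2" and "a > -2" "s > 0" "\<delta> > 0" "\<mu> > 0"
    and D: "\<delta> * \<mu> - (1 - s)\<^sup>2 > 0" and above: "(\<delta>, \<mu>) \<in> above_C (real DIM('n)) a s"
  shows "\<exists>u v. ground_state TYPE('n) a s \<delta> \<mu> u v"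
proof -
  define \<beta> where "\<beta> = 2 + a"
  define \<kappa> where "\<kappa> = (real DIM('n) + a) / \<beta>"
  have \<beta>: "\<beta> > 0" using assms by (simp add: \<beta>_def)
  have \<kappa>\<beta>: "\<kappa> * \<beta> = real DIM('n) + a" using \<beta> by (simp add: \<kappa>_def)
  have N2: "real DIM('n) - 2 = (\<kappa> - 1) * \<beta>"
    using \<kappa>\<beta> by (simp add: left_diff_distrib \<beta>_def)
  have \<kappa>: "\<kappa> > 1"
    using N \<beta> by (simp add: \<kappa>_def \<beta>_def)
  have "\<kappa> / (\<mu> + 1) + \<kappa> / (\<delta> + 1)
      < (\<kappa> - 1) + (\<kappa> - 1) * s / 2 * min (1 / (\<mu> + 1)) (1 / (\<delta> + 1))" (is "?l < ?r")
  proof -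
    have "?l * \<beta> < ?r * \<beta>"
      using above unfolding above_C_def N2 \<kappa>\<beta>[symmetric] by (simp add: algebra_simps)
    then show ?thesis using \<beta> by simp
  qed
  then obtain u v P Q where
    u: "radial_poisson \<kappa> (power_source s \<delta> u v) u P" and
    v: "radial_poisson \<kappa> (power_source s \<mu> v u) v Q" and
    pos: "\<forall>x\<ge>0. u x > 0 \<and> v x > 0"
    by (rule entire_positive_pair[OF \<kappa> \<open>s > 0\<close> \<open>\<delta> > 0\<close> \<open>\<mu> > 0\<close> D]) (rule that)
  define U V where "U r = u (emden_radius \<beta> r)" and "V r = v (emden_radius \<beta> r)" for r
  have cont: "continuous_on {0..} (power_source s \<delta> u v)" "continuous_on {0..} (power_source s \<mu> v u)"
    using assms radial_poissonD(1)[OF u] radial_poissonD(1)[OF v]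
    by (auto intro: continuous_power_source)
  note pU = radial_poisson_pullback[OF \<beta>_def \<beta> \<kappa>\<beta> u cont(1), folded U_def]
  note pV = radial_poisson_pullback[OF \<beta>_def \<beta> \<kappa>\<beta> v cont(2), folded V_def]
  have UV: "U r > 0" "V r > 0" for r
    using pos emden_radius_nonneg by (auto simp: U_def V_def)
  have e: "einterval 0 \<infinity> = {0::real<..}"
    by (auto simp: einterval_def)
  have e': "{r. 0 \<le> r \<and> ereal r < \<infinity>} = {0::real..}" by auto
  have "ground_state TYPE('n) a s \<delta> \<mu> U V"
    unfolding ground_state_def positive_radial_solution_def regular_at_0_def e e'
  proof (intro conjI ballI allI impI)
    fix x :: 'n assume "norm x \<in> {0<..}"
    then have x: "x \<noteq> 0" by simp
    show "- laplacian (\<lambda>y. U (norm y)) x = norm x powr a * U (norm x) powr s * V (norm x) powr \<delta>"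
      using pU(3)[OF x] UV[of "norm x"] by (simp add: power_source_def U_def V_def)
    show "- laplacian (\<lambda>y. V (norm y)) x = norm x powr a * U (norm x) powr \<mu> * V (norm x) powr s"
      using pV(3)[OF x] UV[of "norm x"] by (simp add: power_source_def U_def V_def)
  qed (use pU pV UV in auto)
  then show ?thesis by blast
qed

theorem theorem1p5:
  fixes a s :: real
  assumes "DIM('n::euclidean_space) > 2"
    and "a > -2"
    and "s > 0"
  shows "curve_C (real DIM('n)) a s \<subseteq> under_hyperbola (real DIM('n)) a \<and>
    (\<forall>\<delta> \<mu>. \<delta> > 0 \<longrightarrow> \<mu> > 0 \<longrightarrow> \<delta> * \<mu> - (1 - s)\<^sup>2 > 0 \<longrightarrow>
       (\<delta>, \<mu>) \<in> above_C (real DIM('n)) a s \<longrightarrow>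
       (\<exists>u v. ground_state TYPE('n) a s \<delta> \<mu> u v))"
  using curve_subset_under_hyperbola[of "real DIM('n)" s a] ground_state_above_C[where 'n = 'n] assms
  by simp

end
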